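(* Assume Assumptions (LS), (UT), (LT) and (LB) below hold, with $\alpha>0$ the common exponent in (UT) and (LT). Then there exist constants $c>0$, $\eta>0$, $\theta_0$ and $r_0$ (depending on $\alpha$) such that for all $r>r_0$ and $\theta_0<\theta<\eta r^{2/3}$, $$\mathbb{P}\left(X_r-\mathbb{E}[X_r]\le-\theta r^{1/3}\right)\ge\exp\left(-c\theta^3\right).$$
   Context: Let $\{\xi_v:v\in\mathbb{Z}^2\}$ be i.i.d. random variables with a common law $\nu$ supported on $[0,\infty)$. A directed path is an up-right nearest-neighbour path in $\mathbb{Z}^2$, and its weight is $\ell(\gamma)=\sum_{u\in\gamma}\xi_u$. For $u\preceq v$ coordinatewise, $X_{u,v}=\max_{\gamma:u\to v}\ell(\gamma)$ over directed paths from $u$ to $v$ ($-\infty$ if none). For $r\in\mathbb{N}$, $z\in\mathbb{Z}$, $X_r^z=X_{(1,1),(r-z,r+z)}$ and $X_r=X_r^0$. It is assumed that $\mu=\lim_{r\to\infty}r^{-1}\mathbb{E}[X_r]<\infty$. Assumption (LS): there exist positive finite constants $\rho,G,H,g_1,g_2$ such that for all large enough $r$ and all $z\in[-\rho r,\rho r]$, $\mathbb{E}[X_r^z]\in \mu r-G\frac{z^2}{r}+\left[-H\frac{z^4}{r^3},0\right]+\left[-g_1r^{1/3},-g_2r^{1/3}\right]$. Assumptions (UT) and (LT): there exists $\alpha>0$ such that for every $\varepsilon>0$ there exist positive finite $c,\theta_0,r_0$ (depending only on $\varepsilon$) such that for all $r>r_0$, $\theta>\theta_0$ and $|z|\le(1-\varepsilon)r$: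 (UT) $\mathbb{P}(X_r^z-\mathbb{E}[X_r^z]>\theta r^{1/3})\le\exp(-c\theta^\alpha)$ and (LT) $\mathbb{P}(X_r^z-\mathbb{E}[X_r^z]<-\theta r^{1/3})\le\exp(-c\theta^\alpha)$. Assumption (LB): there exist constants $\delta>0$, $C>0$, $r_0$ such that for all $r>r_0$, $\mathbb{P}(X_r-\mu r<-Cr^{1/3})\ge\delta$. *)

theory Defs
  imports "HOL-Probability.Probability"
begin

definition up_right :: "(int \<times> int) list \<Rightarrow> bool" where
  "up_right \<gamma> \<longleftrightarrow> (\<forall>i. Suc i < length \<gamma> \<longrightarrow>
      (\<gamma> ! Suc i = (fst (\<gamma> ! i) + 1, snd (\<gamma> ! i)) \<or>
       \<gamma> ! Suc i = (fst (\<gamma> ! i), snd (\<gamma> ! i) + 1)))"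

definition dpaths :: "int \<times> int \<Rightarrow> int \<times> int \<Rightarrow> (int \<times> int) list set" where
  "dpaths u v = {\<gamma>. \<gamma> \<noteq> [] \<and> hd \<gamma> = u \<and> last \<gamma> = v \<and> up_right \<gamma>}"

definition path_weight :: "(int \<times> int \<Rightarrow> real) \<Rightarrow> (int \<times> int) list \<Rightarrow> real" where
  "path_weight w \<gamma> = sum_list (map w \<gamma>)"

text \<open>Last passage value X_{u,v} (only meaningful when a directed path u \<rightarrow> v exists).\<close>
definition lpp :: "(int \<times> int \<Rightarrow> real) \<Rightarrow> int \<times> int \<Rightarrow> int \<times> int \<Rightarrow> real" where
  "lpp w u v = Max (path_weight w ` dpaths u v)"

definition Xrz :: "(int \<times> int \<Rightarrow> 'a \<Rightarrow> real) \<Rightarrow> nat \<Rightarrow> int \<Rightarrow> 'a \<Rightarrow> real" where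
  "Xrz \<xi> r z \<omega> = lpp (\<lambda>v. \<xi> v \<omega>) (1, 1) (int r - z, int r + z)"

end

theory Submission
  imports Defs "HOL-Real_Asymp.Real_Asymp"
begin

text \<open>Cut the square into \<open>k \<approx> \<theta>\<^sup>3\<^sup>/\<^sup>2\<close> slabs orthogonal to the diagonal, of height of order
  \<open>r / k\<close>, and each slab into columns of width of order \<open>(r / k)\<^sup>2\<^sup>/\<^sup>3\<close>. If every crossing of every
  slab falls short of its typical value by a constant times \<open>(r / k)\<^sup>1\<^sup>/\<^sup>3\<close>, then the total deficit is of
  order \<open>k (r / k)\<^sup>1\<^sup>/\<^sup>3 \<approx> \<theta> r\<^sup>1\<^sup>/\<^sup>3\<close>. A block near the diagonal achieves this with probability bounded
  below. Far from the diagonal, or between distant columns, less is demanded: a path visiting column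
  \<open>j\<close> pays for the lateral excursion through the curvature in (LS), so the admissible level may grow
  like \<open>|j| / k\<close>, and the probability of failure is summable by (UT). All these events are decreasing,
  hence Harris' inequality bounds the probability of their intersection below by the product, which
  is \<open>exp (- O(k\<^sup>2)) = exp (- O(\<theta>\<^sup>3))\<close>.\<close>

section \<open>Directed paths and last passage values\<close>

definition nn_step :: "int \<times> int \<Rightarrow> int \<times> int \<Rightarrow> bool" where
  "nn_step x y \<longleftrightarrow> y = x + (1, 0) \<or> y = x + (0, 1)"

lemma up_right_iff_successively: "up_right \<gamma> \<longleftrightarrow> successively nn_step \<gamma>"
  unfolding up_right_def successively_conv_nth nn_step_def by (auto simp: prod_eq_iff)

lemma nn_step_less: "nn_step x y \<Longrightarrow> x < y"
  by (auto simp: nn_step_def less_le_not_le less_eq_prod_def)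

lemma up_right_imp_sorted_wrt: "up_right \<gamma> \<Longrightarrow> sorted_wrt (<) \<gamma>"
  by (metis up_right_iff_successively successively_mono nn_step_less
      successively_conv_sorted_wrt transp_on_less)

lemma dpathsE:
  assumes "\<gamma> \<in> dpaths u v"
  obtains "\<gamma> \<noteq> []" "hd \<gamma> = u" "last \<gamma> = v" "successively nn_step \<gamma>" "sorted_wrt (<) \<gamma>"
  using assms up_right_imp_sorted_wrt by (auto simp: dpaths_def up_right_iff_successively)

lemma dpathsI:
  "\<gamma> \<noteq> [] \<Longrightarrow> hd \<gamma> = u \<Longrightarrow> last \<gamma> = v \<Longrightarrow> successively nn_step \<gamma> \<Longrightarrow> \<gamma> \<in> dpaths u v"
  by (simp add: dpaths_def up_right_iff_successively)

lemma dpaths_subset_interval: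
  assumes "\<gamma> \<in> dpaths u v"
  shows "set \<gamma> \<subseteq> {u..v}"
  using assms
proof (rule dpathsE)
  assume "\<gamma> \<noteq> []" and ends: "hd \<gamma> = u" "last \<gamma> = v" and "sorted_wrt (<) \<gamma>"
  then have "sorted_wrt (\<le>) \<gamma>"
    using sorted_wrt_mono_rel[of \<gamma> "(<)" "(\<le>)"] by simp
  then have "u \<le> \<gamma> ! i \<and> \<gamma> ! i \<le> v" if "i < length \<gamma>" for i
    using that ends \<open>\<gamma> \<noteq> []\<close>
    by (cases "i = 0"; cases "i = length \<gamma> - 1")
      (auto simp: hd_conv_nth last_conv_nth intro: sorted_wrt_nth_less)
  then show ?thesis unfolding subset_eq all_set_conv_all_nth by simp
qed

lemma dpaths_imp_le: "\<gamma> \<in> dpaths u v \<Longrightarrow> u \<le> v"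
  using dpaths_subset_interval by (fastforce elim: dpathsE dest: hd_in_set last_in_set)

lemma dpaths_empty_iff: "dpaths u v = {} \<longleftrightarrow> \<not> u \<le> v"
proof -
  have "dpaths u v \<noteq> {}" if "u \<le> v"
    using that
  proof (induction "nat (fst v - fst u + (snd v - snd u))" arbitrary: u)
    case 0
    then have "u = v" by (auto simp: less_eq_prod_def prod_eq_iff)
    then have "[u] \<in> dpaths u v" by (simp add: dpathsI)
    then show ?case by blast
  next
    case (Suc n)
    define y where "y = (if fst u < fst v then u + (1, 0) else u + (0, 1))"
    have "n = nat (fst v - fst y + (snd v - snd y))" "y \<le> v"
      using Suc.hyps(2) Suc.prems by (auto simp: y_def less_eq_prod_def)
    then obtain \<gamma> where "\<gamma> \<in> dpaths y v" using Suc.hyps(1) by blast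
    moreover have "nn_step u y" by (simp add: y_def nn_step_def)
    ultimately have "u # \<gamma> \<in> dpaths u v"
      by (elim dpathsE, intro dpathsI) (auto simp: successively_Cons)
    then show ?case by blast
  qed
  then show ?thesis using dpaths_imp_le by blast
qed

lemma finite_interval_int_prod [simp]: "finite {u..v :: int \<times> int}"
  by (simp add: atLeastAtMost_prod_eq)

lemma finite_dpaths [simp]: "finite (dpaths u v)"
proof (rule finite_subset)
  have "distinct \<gamma>" if "sorted_wrt (<) \<gamma>" for \<gamma> :: "(int \<times> int) list"
    using that by (induction \<gamma>) auto
  then show "dpaths u v \<subseteq> {\<gamma>. set \<gamma> \<subseteq> {u..v} \<and> distinct \<gamma>}"
    using dpaths_subset_interval by (blast elim: dpathsE)
qed (rule finite_subset_distinct, simp)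

lemma path_weight_le_lpp: "\<gamma> \<in> dpaths u v \<Longrightarrow> path_weight w \<gamma> \<le> lpp w u v"
  by (simp add: lpp_def)

lemma lpp_attained:
  assumes "u \<le> v"
  obtains \<gamma> where "\<gamma> \<in> dpaths u v" "lpp w u v = path_weight w \<gamma>"
proof -
  have "lpp w u v \<in> path_weight w ` dpaths u v"
    unfolding lpp_def using assms by (intro Max_in) (auto simp: dpaths_empty_iff)
  then show ?thesis using that by blast
qed

lemma lpp_le_iff:
  "u \<le> v \<Longrightarrow> lpp w u v \<le> t \<longleftrightarrow> (\<forall>\<gamma>\<in>dpaths u v. path_weight w \<gamma> \<le> t)"
  by (simp add: lpp_def dpaths_empty_iff)

lemma lpp_cong:
  assumes "\<And>x. x \<in> {u..v} \<Longrightarrow> w x = w' x"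
  shows "lpp w u v = lpp w' u v"
  unfolding lpp_def path_weight_def
  using assms dpaths_subset_interval
  by (intro arg_cong[of _ _ Max] image_cong arg_cong[of _ _ sum_list] map_cong) blast+

lemma lpp_mono:
  assumes "\<And>x. x \<in> {u..v} \<Longrightarrow> w x \<le> w' x"
  shows "lpp w u v \<le> lpp w' u v"
proof (cases "u \<le> v")
  case True
  then obtain \<gamma> where \<gamma>: "\<gamma> \<in> dpaths u v" "lpp w u v = path_weight w \<gamma>"
    by (rule lpp_attained)
  have "path_weight w \<gamma> \<le> path_weight w' \<gamma>"
    unfolding path_weight_def
    using dpaths_subset_interval[OF \<gamma>(1)] assms by (intro sum_list_mono) blast
  also have "\<dots> \<le> lpp w' u v" by (rule path_weight_le_lpp[OF \<gamma>(1)])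
  finally show ?thesis using \<gamma>(2) by simp
qed (simp add: lpp_def flip: dpaths_empty_iff)

lemma lpp_nonneg:
  assumes "\<And>x. 0 \<le> w x" "u \<le> v"
  shows "0 \<le> lpp w u v"
  using assms(2)
proof (rule lpp_attained)
  fix \<gamma> assume "lpp w u v = path_weight w \<gamma>"
  then show ?thesis using assms(1) by (auto simp: path_weight_def intro!: sum_list_nonneg)
qed

lemma dpaths_map:
  assumes f: "bij f" "\<And>x y. nn_step (f x) (f y) \<longleftrightarrow> nn_step x y"
  shows "dpaths (f u) (f v) = map f ` dpaths u v"
proof -
  have steps: "successively nn_step (map f \<gamma>) \<longleftrightarrow> successively nn_step \<gamma>" for \<gamma>
    by (simp add: successively_map f(2))
  show ?thesis
  proof (intro equalityI subsetI)
    fix \<gamma> assume "\<gamma> \<in> dpaths (f u) (f v)"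
    moreover define \<gamma>' where "\<gamma>' = map (inv f) \<gamma>"
    moreover have "map f \<gamma>' = \<gamma>"
      by (simp add: \<gamma>'_def o_def surj_f_inv_f[OF bij_is_surj[OF f(1)]])
    ultimately have "\<gamma>' \<in> dpaths u v"
      using steps[of \<gamma>'] f(1)
      by (elim dpathsE, intro dpathsI) (auto simp: hd_map last_map bij_is_inj)
    then show "\<gamma> \<in> map f ` dpaths u v" using \<open>map f \<gamma>' = \<gamma>\<close> by blast
  next
    fix \<gamma> assume "\<gamma> \<in> map f ` dpaths u v"
    then show "\<gamma> \<in> dpaths (f u) (f v)"
      by (auto elim!: dpathsE intro!: dpathsI simp: hd_map last_map steps)
  qed
qed

lemma lpp_map:
  assumes "bij f" "\<And>x y. nn_step (f x) (f y) \<longleftrightarrow> nn_step x y"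
  shows "lpp w (f u) (f v) = lpp (\<lambda>x. w (f x)) u v"
  by (simp add: lpp_def path_weight_def dpaths_map[OF assms] image_image o_def)

lemma lpp_shift: "lpp w (u + a) (v + a) = lpp (\<lambda>x. w (x + a)) u v"
  by (rule lpp_map) (auto simp: nn_step_def add_ac intro: bij_plus_right)

lemma lpp_swap: "lpp w (prod.swap u) (prod.swap v) = lpp (\<lambda>x. w (prod.swap x)) u v"
  by (rule lpp_map) (auto simp: nn_step_def prod_eq_iff)

lemma lpp_superadditive:
  assumes w: "\<And>x. 0 \<le> w x" and "a \<le> u" "u + (1, 1) \<le> b"
  shows "lpp w a u + lpp w (u + (1, 1)) b \<le> lpp w a b"
proof -
  obtain \<gamma> where \<gamma>: "\<gamma> \<in> dpaths a u" "lpp w a u = path_weight w \<gamma>"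
    using lpp_attained[OF assms(2)] .
  obtain \<gamma>' where \<gamma>': "\<gamma>' \<in> dpaths (u + (1, 1)) b" "lpp w (u + (1, 1)) b = path_weight w \<gamma>'"
    using lpp_attained[OF assms(3)] .
  have "nn_step u (u + (1, 0))" "nn_step (u + (1, 0)) (u + (1, 1))"
    by (auto simp: nn_step_def prod_eq_iff)
  then have "\<gamma> @ (u + (1, 0)) # \<gamma>' \<in> dpaths a b"
    using \<gamma>(1) \<gamma>'(1)
    by (elim dpathsE, intro dpathsI) (auto simp: successively_append_iff successively_Cons)
  from path_weight_le_lpp[OF this, of w] show ?thesis
    using \<gamma>(2) \<gamma>'(2) w[of "u + (1, 0)"] by (simp add: path_weight_def)
qed

definition level :: "int \<times> int \<Rightarrow> int" where
  "level v = fst v + snd v"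

lemma dpath_crosses_level:
  assumes "\<gamma> \<in> dpaths a b" "level a \<le> L" "L \<le> level b"
  obtains c where "c \<in> set \<gamma>" "level c = L"
  using assms(1)
proof (rule dpathsE)
  assume "\<gamma> \<noteq> []" "hd \<gamma> = a" "last \<gamma> = b" and steps: "successively nn_step \<gamma>"
  have "\<exists>i. 0 \<le> i \<and> i \<le> length \<gamma> - 1 \<and> level (\<gamma> ! i) = L"
  proof (rule nat_intermed_int_val)
    have "nn_step (\<gamma> ! i) (\<gamma> ! Suc i)" if "i < length \<gamma> - 1" for i
      using successively_nth[OF steps] that by simp
    then show "\<forall>i. 0 \<le> i \<and> i < length \<gamma> - 1 \<longrightarrow> \<bar>level (\<gamma> ! Suc i) - level (\<gamma> ! i)\<bar> \<le> 1"
      by (fastforce simp: nn_step_def level_def)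
    show "level (\<gamma> ! 0) \<le> L" "L \<le> level (\<gamma> ! (length \<gamma> - 1))"
      using assms(2,3) \<open>\<gamma> \<noteq> []\<close> \<open>hd \<gamma> = a\<close> \<open>last \<gamma> = b\<close>
      by (simp_all add: hd_conv_nth last_conv_nth)
  qed simp
  then show ?thesis
    using that \<open>\<gamma> \<noteq> []\<close> by (metis Suc_pred' le_imp_less_Suc length_greater_0_conv nth_mem)
qed

lemma path_weight_le_lpp_via:
  assumes w: "\<And>x. 0 \<le> w x" and "\<gamma> \<in> dpaths a b" "c \<in> set \<gamma>"
  shows "path_weight w \<gamma> \<le> lpp w a c + lpp w c b"
proof -
  obtain xs ys where \<gamma>: "\<gamma> = xs @ c # ys" using split_list[OF assms(3)] by blast
  have "xs @ [c] \<in> dpaths a c" "c # ys \<in> dpaths c b"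
    using assms(2) unfolding \<gamma>
    by (auto elim!: dpathsE intro!: dpathsI simp: successively_append_iff hd_append)
  from this[THEN path_weight_le_lpp[where w = w]] show ?thesis
    using w[of c] by (simp add: \<gamma> path_weight_def)
qed

lemma lpp_split_level:
  assumes w: "\<And>x. 0 \<le> w x" and "a \<le> b" and L: "level a \<le> L" "L \<le> level b"
  obtains c where "a \<le> c" "c \<le> b" "level c = L" "lpp w a b \<le> lpp w a c + lpp w c b"
proof -
  obtain \<gamma> where \<gamma>: "\<gamma> \<in> dpaths a b" "lpp w a b = path_weight w \<gamma>"
    using lpp_attained[OF assms(2)] .
  obtain c where "c \<in> set \<gamma>" "level c = L" using dpath_crosses_level[OF \<gamma>(1) L] .
  moreover from this have "a \<le> c" "c \<le> b" using dpaths_subset_interval[OF \<gamma>(1)] by auto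
  moreover have "lpp w a b \<le> lpp w a c + lpp w c b"
    using path_weight_le_lpp_via[OF w \<gamma>(1) \<open>c \<in> set \<gamma>\<close>] \<gamma>(2) by simp
  ultimately show ?thesis using that by blast
qed

section \<open>Harris' inequality\<close>

lemma (in prob_space) integral_mult_ge_if_comonotone:
  fixes f g :: "'a \<Rightarrow> real"
  assumes [simp]: "integrable M f" "integrable M g" "integrable M (\<lambda>x. f x * g x)"
    and comonotone: "\<And>x y. x \<in> space M \<Longrightarrow> y \<in> space M \<Longrightarrow> 0 \<le> (f x - f y) * (g x - g y)"
  shows "(\<integral>x. f x \<partial>M) * (\<integral>x. g x \<partial>M) \<le> (\<integral>x. f x * g x \<partial>M)"
proof -
  let ?F = "\<integral>x. f x \<partial>M" and ?G = "\<integral>x. g x \<partial>M" and ?FG = "\<integral>x. f x * g x \<partial>M"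
  have inner: "0 \<le> f x * g x - f x * ?G - g x * ?F + ?FG" if "x \<in> space M" for x
  proof -
    have "0 \<le> (\<integral>y. (f x - f y) * (g x - g y) \<partial>M)"
      using comonotone that by (intro Bochner_Integration.integral_nonneg) auto
    also have "\<dots> = (\<integral>y. f x * g x - f x * g y - g x * f y + f y * g y \<partial>M)"
      by (simp add: algebra_simps)
    also have "\<dots> = f x * g x - f x * ?G - g x * ?F + ?FG"
      by (simp add: prob_space)
    finally show ?thesis .
  qed
  have "0 \<le> (\<integral>x. f x * g x - f x * ?G - g x * ?F + ?FG \<partial>M)"
    by (intro Bochner_Integration.integral_nonneg inner)
  also have "\<dots> = 2 * ?FG - 2 * (?F * ?G)"
    by (simp add: prob_space)
  finally show ?thesis by simp
qed

definition unit_antimono :: "'a :: order measure \<Rightarrow> ('a \<Rightarrow> real) \<Rightarrow> bool" where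
  "unit_antimono M f \<longleftrightarrow>
    f \<in> borel_measurable M \<and> f \<in> space M \<rightarrow> {0..1} \<and> antimono_on (space M) f"

lemma unit_antimonoI:
  assumes "f \<in> borel_measurable M" "\<And>x. x \<in> space M \<Longrightarrow> 0 \<le> f x"
    and "\<And>x. x \<in> space M \<Longrightarrow> f x \<le> 1"
    and "\<And>x y. x \<in> space M \<Longrightarrow> y \<in> space M \<Longrightarrow> x \<le> y \<Longrightarrow> f y \<le> f x"
  shows "unit_antimono M f"
  using assms by (auto simp: unit_antimono_def monotone_on_def)

lemma unit_antimonoD:
  assumes "unit_antimono M f"
  shows "f \<in> borel_measurable M" "x \<in> space M \<Longrightarrow> 0 \<le> f x" "x \<in> space M \<Longrightarrow> f x \<le> 1"
    and "x \<in> space M \<Longrightarrow> y \<in> space M \<Longrightarrow> x \<le> y \<Longrightarrow> f y \<le> f x"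
  using assms by (auto simp: unit_antimono_def monotone_on_def)

lemma unit_antimono_mult:
  "unit_antimono M f \<Longrightarrow> unit_antimono M g \<Longrightarrow> unit_antimono M (\<lambda>x. f x * g x)"
  by (intro unit_antimonoI borel_measurable_times mult_nonneg_nonneg mult_le_one mult_mono)
    (auto dest: unit_antimonoD)

lemma integrable_unit_antimono:
  assumes "prob_space M" "unit_antimono M f"
  shows "integrable M f"
proof -
  interpret prob_space M by fact
  show ?thesis
    using unit_antimonoD[OF assms(2)] by (intro integrable_const_bound[where B = 1]) auto
qed

lemma chebyshev_association:
  fixes f g :: "'a :: linorder \<Rightarrow> real"
  assumes "prob_space M" and f: "unit_antimono M f" and g: "unit_antimono M g"
  shows "(\<integral>x. f x \<partial>M) * (\<integral>x. g x \<partial>M) \<le> (\<integral>x. f x * g x \<partial>M)"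
proof -
  interpret prob_space M by fact
  show ?thesis
  proof (rule integral_mult_ge_if_comonotone)
    fix x y assume "x \<in> space M" "y \<in> space M"
    then show "0 \<le> (f x - f y) * (g x - g y)"
      using unit_antimonoD(4)[OF f] unit_antimonoD(4)[OF g]
      by (cases "x \<le> y") (simp_all add: mult_nonneg_nonneg mult_nonpos_nonpos)
  qed (intro integrable_unit_antimono assms unit_antimono_mult)+
qed

context
  fixes M :: "'i \<Rightarrow> 'a :: linorder measure"
  assumes prob: "\<And>i. prob_space (M i)"
begin

lemma fun_upd_mem_space_PiM:
  "x \<in> space (PiM I M) \<Longrightarrow> y \<in> space (M i) \<Longrightarrow> x(i := y) \<in> space (PiM (insert i I) M)"
  by (auto simp: space_PiM PiE_iff extensional_def)

lemma unit_antimono_section: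
  assumes f: "unit_antimono (PiM (insert i I) M) f" and x: "x \<in> space (PiM I M)" and "i \<notin> I"
  shows "unit_antimono (M i) (\<lambda>y. f (x(i := y)))"
proof (rule unit_antimonoI)
  show "(\<lambda>y. f (x(i := y))) \<in> borel_measurable (M i)"
    using measurable_compose[OF measurable_component_update[OF x \<open>i \<notin> I\<close>] unit_antimonoD(1)[OF f]] .
qed (use x in \<open>auto intro!: unit_antimonoD[OF f] fun_upd_mem_space_PiM simp: le_fun_def\<close>)

lemma unit_antimono_marginal:
  assumes f: "unit_antimono (PiM (insert i I) M) f" and "i \<notin> I"
  shows "unit_antimono (PiM I M) (\<lambda>x. \<integral>y. f (x(i := y)) \<partial>M i)"
proof (rule unit_antimonoI)
  interpret prob_space "M i" by (rule prob)
  have int: "integrable (M i) (\<lambda>y. f (x(i := y)))" if "x \<in> space (PiM I M)" for x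
    using that assms by (intro integrable_unit_antimono prob unit_antimono_section)
  have "(\<lambda>(x, y). f (x(i := y))) \<in> borel_measurable (PiM I M \<Otimes>\<^sub>M M i)"
    using measurable_compose[OF measurable_add_dim unit_antimonoD(1)[OF f]]
    by (simp add: split_beta')
  then show "(\<lambda>x. \<integral>y. f (x(i := y)) \<partial>M i) \<in> borel_measurable (PiM I M)"
    by (rule borel_measurable_lebesgue_integral)
  fix x assume x: "x \<in> space (PiM I M)"
  show "0 \<le> (\<integral>y. f (x(i := y)) \<partial>M i)"
    using x by (intro Bochner_Integration.integral_nonneg unit_antimonoD(2)[OF f]
        fun_upd_mem_space_PiM)
  show "(\<integral>y. f (x(i := y)) \<partial>M i) \<le> 1"
    using x by (intro integral_le_const int AE_I2 unit_antimonoD(3)[OF f] fun_upd_mem_space_PiM)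
  fix z assume "z \<in> space (PiM I M)" "x \<le> z"
  with x show "(\<integral>y. f (z(i := y)) \<partial>M i) \<le> (\<integral>y. f (x(i := y)) \<partial>M i)"
    by (intro integral_mono int unit_antimonoD(4)[OF f] fun_upd_mem_space_PiM)
      (auto simp: le_fun_def)
qed

text \<open>Integrating out one coordinate preserves monotonicity, so the one-dimensional association
  inequality iterates. On extensional functions the pointwise order compares the coordinates in
  \<open>I\<close> only.\<close>

lemma harris_PiM:
  assumes "finite I" and "unit_antimono (PiM I M) f" "unit_antimono (PiM I M) g"
  shows "(\<integral>x. f x \<partial>PiM I M) * (\<integral>x. g x \<partial>PiM I M) \<le> (\<integral>x. f x * g x \<partial>PiM I M)"
  using assms
proof (induction I arbitrary: f g rule: finite_induct)
  case empty
  then show ?case by (simp add: PiM_empty lebesgue_integral_count_space_finite)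
next
  case (insert i I)
  interpret product_sigma_finite M
    by (simp add: product_sigma_finite_def prob prob_space_imp_sigma_finite)
  let ?marginal = "\<lambda>f x. \<integral>y. f (x(i := y)) \<partial>M i"
  have integral_marginal: "(\<integral>x. h x \<partial>PiM (insert i I) M) = (\<integral>x. ?marginal h x \<partial>PiM I M)"
    if "unit_antimono (PiM (insert i I) M) h" for h
    using that insert.hyps
    by (intro product_integral_insert integrable_unit_antimono prob_space_PiM prob)
  have marginal: "unit_antimono (PiM I M) (?marginal h)"
    if "unit_antimono (PiM (insert i I) M) h" for h
    using that insert.hyps(2) by (rule unit_antimono_marginal)
  note fg = unit_antimono_mult[OF insert.prems]
  have "(\<integral>x. f x \<partial>PiM (insert i I) M) * (\<integral>x. g x \<partial>PiM (insert i I) M)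
      = (\<integral>x. ?marginal f x \<partial>PiM I M) * (\<integral>x. ?marginal g x \<partial>PiM I M)"
    by (simp add: integral_marginal insert.prems)
  also have "\<dots> \<le> (\<integral>x. ?marginal f x * ?marginal g x \<partial>PiM I M)"
    by (intro insert.IH marginal insert.prems)
  also have "\<dots> \<le> (\<integral>x. ?marginal (\<lambda>x. f x * g x) x \<partial>PiM I M)"
    using insert.hyps(2) insert.prems fg
    by (intro integral_mono integrable_unit_antimono prob_space_PiM unit_antimono_mult marginal
        chebyshev_association prob unit_antimono_section)
  also have "\<dots> = (\<integral>x. f x * g x \<partial>PiM (insert i I) M)"
    by (simp add: integral_marginal fg)
  finally show ?case .
qed

end

section \<open>The product environment\<close>

definition depends_on :: "'i set \<Rightarrow> (('i \<Rightarrow> 'a) \<Rightarrow> bool) \<Rightarrow> bool" where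
  "depends_on F Q \<longleftrightarrow> (\<forall>w w'. (\<forall>v\<in>F. w v = w' v) \<longrightarrow> Q w = Q w')"

definition decreasing_on :: "'i set \<Rightarrow> (('i \<Rightarrow> 'a :: order) \<Rightarrow> bool) \<Rightarrow> bool" where
  "decreasing_on F Q \<longleftrightarrow> (\<forall>w w'. (\<forall>v\<in>F. w v \<le> w' v) \<longrightarrow> Q w' \<longrightarrow> Q w)"

lemma depends_on_restrict: "depends_on F Q \<Longrightarrow> Q (restrict w F) = Q w"
  by (simp add: depends_on_def)

lemma depends_on_not: "depends_on F Q \<Longrightarrow> depends_on F (\<lambda>w. \<not> Q w)"
  unfolding depends_on_def by blast

lemma depends_on_conj:
  "depends_on F Q \<Longrightarrow> depends_on G R \<Longrightarrow> depends_on (F \<union> G) (\<lambda>w. Q w \<and> R w)"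
  unfolding depends_on_def by (meson UnI1 UnI2)

lemma decreasing_on_mono: "decreasing_on F Q \<Longrightarrow> F \<subseteq> G \<Longrightarrow> decreasing_on G Q"
  unfolding decreasing_on_def by (meson subsetD)

lemma decreasing_on_conj:
  "decreasing_on F Q \<Longrightarrow> decreasing_on F R \<Longrightarrow> decreasing_on F (\<lambda>w. Q w \<and> R w)"
  unfolding decreasing_on_def by blast

lemma decreasing_on_imp_depends_on: "decreasing_on F Q \<Longrightarrow> depends_on F Q"
  unfolding decreasing_on_def depends_on_def by (metis order_refl)

text \<open>Events are predicates on weight configurations; a configuration is drawn from the infinite
  product \<open>env\<close>, whose underlying space is the full function type.\<close>

locale iid_field = prob_space \<nu> for \<nu> :: "real measure" +
  assumes sets_nu [measurable_cong]: "sets \<nu> = sets borel"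
    and nu_nonneg: "AE x in \<nu>. 0 \<le> x"
begin

definition env :: "(int \<times> int \<Rightarrow> real) measure" where
  "env = PiM UNIV (\<lambda>_. \<nu>)"

definition pr :: "((int \<times> int \<Rightarrow> real) \<Rightarrow> bool) \<Rightarrow> real" where
  "pr Q = measure env {w. Q w}"

lemma space_nu [simp]: "space \<nu> = UNIV"
  using sets_eq_imp_space_eq[OF sets_nu] by simp

lemma space_env [simp]: "space env = UNIV"
  by (simp add: env_def space_PiM)

sublocale env: prob_space env
  unfolding env_def by (intro prob_space_PiM) (rule prob_space_axioms)

lemma measurable_coordinate [measurable]: "(\<lambda>w. w v) \<in> borel_measurable env"
proof -
  have "(\<lambda>w. w v) \<in> measurable env \<nu>" unfolding env_def by measurable
  then show ?thesis by (simp add: measurable_cong_sets[OF refl sets_nu])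
qed

lemma measurable_path_weight [measurable]: "(\<lambda>w. path_weight w \<gamma>) \<in> borel_measurable env"
  unfolding path_weight_def by (induction \<gamma>) auto

lemma measurable_lpp [measurable]: "(\<lambda>w. lpp w u v) \<in> borel_measurable env"
proof (cases "u \<le> v")
  case True
  show ?thesis
  proof (rule borel_measurableI_le)
    fix t
    have "Measurable.pred env (\<lambda>w. \<forall>\<gamma>\<in>dpaths u v. path_weight w \<gamma> \<le> t)"
      by (intro pred_intros_finite) auto
    then show "{w \<in> space env. lpp w u v \<le> t} \<in> sets env"
      using True by (simp add: lpp_le_iff pred_def)
  qed
next
  case False
  then have "dpaths u v = {}" by (simp add: dpaths_empty_iff)
  then show ?thesis by (simp add: lpp_def)
qed

lemma pred_sets [simp]: "Measurable.pred env Q \<Longrightarrow> {w. Q w} \<in> sets env"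
  by (simp add: pred_def)

lemma AE_env_nonneg: "AE w in env. \<forall>v. 0 \<le> w v"
  unfolding AE_all_countable env_def
  by (intro allI AE_PiM_component[where P = "\<lambda>x. 0 \<le> x"] nu_nonneg prob_space_axioms) auto

lemma pr_nonneg [simp]: "0 \<le> pr Q" and pr_le_1 [simp]: "pr Q \<le> 1"
  by (simp_all add: pr_def)

lemma pr_True [simp]: "pr (\<lambda>w. True) = 1"
  using env.prob_space by (simp add: pr_def)

lemma pr_False [simp]: "pr (\<lambda>w. False) = 0"
  by (simp add: pr_def)

lemma pr_mono_nonneg:
  assumes "\<And>w. (\<And>v. 0 \<le> w v) \<Longrightarrow> Q w \<Longrightarrow> R w" "Measurable.pred env R"
  shows "pr Q \<le> pr R"
  unfolding pr_def using AE_env_nonneg assms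
  by (intro env.finite_measure_mono_AE) auto

lemma pr_mono: "(\<And>w. Q w \<Longrightarrow> R w) \<Longrightarrow> Measurable.pred env R \<Longrightarrow> pr Q \<le> pr R"
  by (rule pr_mono_nonneg) auto

lemma pr_not: "Measurable.pred env Q \<Longrightarrow> pr (\<lambda>w. \<not> Q w) = 1 - pr Q"
  unfolding pr_def using env.prob_compl[of "{w. Q w}"]
  by (simp add: Collect_neg_eq Compl_eq_Diff_UNIV)

lemma pr_disj_le:
  "Measurable.pred env Q \<Longrightarrow> Measurable.pred env R \<Longrightarrow> pr (\<lambda>w. Q w \<or> R w) \<le> pr Q + pr R"
  unfolding pr_def using measure_Un_le[of "{w. Q w}" env "{w. R w}"] by (simp add: Collect_disj_eq)

lemma pr_disj_eq:
  assumes "Measurable.pred env Q" "Measurable.pred env R" "\<And>w. \<not> (Q w \<and> R w)"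
  shows "pr (\<lambda>w. Q w \<or> R w) = pr Q + pr R"
  unfolding pr_def using env.finite_measure_Union[of "{w. Q w}" "{w. R w}"] assms
  by (auto simp: Collect_disj_eq)

lemma pr_conj_ge:
  assumes [measurable]: "Measurable.pred env Q" "Measurable.pred env R"
  shows "pr Q + pr R - 1 \<le> pr (\<lambda>w. Q w \<and> R w)"
proof -
  have "1 - pr (\<lambda>w. Q w \<and> R w) = pr (\<lambda>w. \<not> Q w \<or> \<not> R w)"
    using pr_not[of "\<lambda>w. Q w \<and> R w"] by (simp only: de_Morgan_conj) simp
  also have "\<dots> \<le> pr (\<lambda>w. \<not> Q w) + pr (\<lambda>w. \<not> R w)"
    by (rule pr_disj_le) measurable
  also have "\<dots> = (1 - pr Q) + (1 - pr R)" by (simp add: pr_not)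
  finally show ?thesis by simp
qed

lemma pr_reindex:
  assumes "bij f" and [measurable]: "Measurable.pred env Q"
  shows "pr (\<lambda>w. Q (\<lambda>v. w (f v))) = pr Q"
proof -
  have reindex: "(\<lambda>w v. w (f v)) \<in> measurable env env"
    unfolding env_def by (rule measurable_PiM_single') (auto simp: space_PiM)
  have "distr env env (\<lambda>w v. w (f v)) = env"
    using distr_PiM_reindex[of UNIV "\<lambda>_. \<nu>" f UNIV] assms(1)
    by (simp add: env_def bij_is_inj prob_space_axioms restrict_def)
  then have "pr Q = measure (distr env env (\<lambda>w v. w (f v))) {w. Q w}" by (simp add: pr_def)
  also have "\<dots> = pr (\<lambda>w. Q (\<lambda>v. w (f v)))"
    unfolding pr_def using reindex by (subst measure_distr) (auto simp: vimage_def)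
  finally show ?thesis by simp
qed

lemma pr_lpp_shift:
  "Measurable.pred borel R \<Longrightarrow> pr (\<lambda>w. R (lpp w (u + a) (v + a))) = pr (\<lambda>w. R (lpp w u v))"
  unfolding lpp_shift
  by (rule pr_reindex[of "\<lambda>x. x + a" "\<lambda>w. R (lpp w u v)"]) (auto intro: bij_plus_right)

lemma pr_lpp_swap:
  "Measurable.pred borel R \<Longrightarrow>
    pr (\<lambda>w. R (lpp w (prod.swap u) (prod.swap v))) = pr (\<lambda>w. R (lpp w u v))"
  unfolding lpp_swap
  by (rule pr_reindex[of prod.swap "\<lambda>w. R (lpp w u v)"]) auto

lemma depends_on_lpp: "{u..v} \<subseteq> F \<Longrightarrow> depends_on F (\<lambda>w. R (lpp w u v))"
  unfolding depends_on_def by (metis lpp_cong subsetD)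

lemma depends_on_pred_PiM:
  assumes "depends_on F Q" "Measurable.pred env Q"
  shows "Measurable.pred (PiM F (\<lambda>_. \<nu>)) Q"
proof -
  have extend: "(\<lambda>w v. if v \<in> F then w v else 0) \<in> measurable (PiM F (\<lambda>_. \<nu>)) env"
    unfolding env_def
  proof (rule measurable_PiM_single')
    show "(\<lambda>w. if v \<in> F then w v else 0) \<in> measurable (PiM F (\<lambda>_. \<nu>)) \<nu>" for v
      by (cases "v \<in> F") auto
  qed (auto simp: space_PiM)
  have "(\<lambda>w. Q (\<lambda>v. if v \<in> F then w v else 0)) = Q"
    using assms(1) by (auto simp: depends_on_def fun_eq_iff)
  with measurable_compose[OF extend assms(2)] show ?thesis by simp
qed

subsection \<open>Independence\<close>

lemma indep_vars_coordinates: "env.indep_vars (\<lambda>_. \<nu>) (\<lambda>v w. w v) UNIV"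
proof (subst env.indep_vars_iff_distr_eq_PiM)
  show "(\<lambda>w. w v) \<in> measurable env \<nu>" for v unfolding env_def by measurable
  have "distr env (PiM UNIV (\<lambda>_. \<nu>)) (\<lambda>w. w) = PiM UNIV (\<lambda>_. \<nu>)"
    unfolding env_def by (rule distr_id2) simp
  moreover have "distr env \<nu> (\<lambda>w. w v) = \<nu>" for v
    unfolding env_def by (rule distr_PiM_component) (auto intro: prob_space_axioms)
  ultimately show "distr env (PiM UNIV (\<lambda>_. \<nu>)) (\<lambda>w. \<lambda>v\<in>UNIV. w v)
      = (\<Pi>\<^sub>M v\<in>UNIV. distr env \<nu> (\<lambda>w. w v))" by (simp add: restrict_def)
qed simp

lemma pr_indep:
  assumes Q: "depends_on F Q" "Measurable.pred env Q"
    and R: "depends_on G R" "Measurable.pred env R" and "F \<inter> G = {}"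
  shows "pr (\<lambda>w. Q w \<and> R w) = pr Q * pr R"
proof -
  have "{w \<in> space (PiM F (\<lambda>_. \<nu>)). Q w} \<in> sets (PiM F (\<lambda>_. \<nu>))"
    "{w \<in> space (PiM G (\<lambda>_. \<nu>)). R w} \<in> sets (PiM G (\<lambda>_. \<nu>))"
    using depends_on_pred_PiM[OF Q] depends_on_pred_PiM[OF R] by auto
  from env.indep_varD[OF env.indep_var_restrict[OF indep_vars_coordinates assms(5)] this]
  show ?thesis
    by (simp add: pr_def vimage_def space_PiM depends_on_restrict Q R)
qed

text \<open>Splitting off the first of the events \<open>Q e\<close> that occurs keeps the decomposition disjoint and
  measurable with respect to \<open>F\<close>, so no union bound over \<open>T\<close> is paid for the events \<open>R e\<close>.\<close>

lemma pr_Bex_indep_ge: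
  assumes "finite T" "F \<inter> G = {}"
    and Q: "\<And>e. e \<in> T \<Longrightarrow> depends_on F (Q e)" "\<And>e. e \<in> T \<Longrightarrow> Measurable.pred env (Q e)"
    and R: "\<And>e. e \<in> T \<Longrightarrow> depends_on G (R e)" "\<And>e. e \<in> T \<Longrightarrow> Measurable.pred env (R e)"
    and R_ge: "\<And>e. e \<in> T \<Longrightarrow> c \<le> pr (R e)"
  shows "c * pr (\<lambda>w. \<exists>e\<in>T. Q e w) \<le> pr (\<lambda>w. \<exists>e\<in>T. Q e w \<and> R e w)"
  using assms(1,3-)
proof (induction T arbitrary: Q rule: finite_induct)
  case (insert e T)
  note [measurable] = insert.prems(2,4)[OF insertI1]
  let ?Q = "\<lambda>e' w. \<not> Q e w \<and> Q e' w"
  have [measurable]: "Measurable.pred env (?Q e')" if "e' \<in> T" for e'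
    using insert.prems(2)[of e'] that by simp
  have meas: "Measurable.pred env (\<lambda>w. \<exists>e'\<in>T. ?Q e' w)"
    "Measurable.pred env (\<lambda>w. \<exists>e'\<in>T. ?Q e' w \<and> R e' w)"
    "Measurable.pred env (\<lambda>w. \<exists>e'\<in>insert e T. Q e' w \<and> R e' w)"
    using insert.hyps(1) insert.prems(2,4) by (intro pred_intros_finite; simp)+
  have "c * pr (\<lambda>w. \<exists>e'\<in>insert e T. Q e' w) = c * pr (\<lambda>w. Q e w \<or> (\<exists>e'\<in>T. ?Q e' w))"
    by (rule arg_cong[of _ _ "\<lambda>Q. c * pr Q"]) auto
  also have "\<dots> = c * pr (Q e) + c * pr (\<lambda>w. \<exists>e'\<in>T. ?Q e' w)"
    by (subst pr_disj_eq[OF _ meas(1)]) (auto simp: distrib_left)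
  also have "\<dots> \<le> pr (\<lambda>w. Q e w \<and> R e w) + pr (\<lambda>w. \<exists>e'\<in>T. ?Q e' w \<and> R e' w)"
  proof (rule add_mono)
    have "pr (\<lambda>w. Q e w \<and> R e w) = pr (Q e) * pr (R e)"
      using insert.prems assms(2) by (intro pr_indep) auto
    then show "c * pr (Q e) \<le> pr (\<lambda>w. Q e w \<and> R e w)"
      using insert.prems(5)[of e] mult_right_mono[of c "pr (R e)" "pr (Q e)"]
      by (simp add: mult.commute)
    have "depends_on F (?Q e')" if "e' \<in> T" for e'
      using depends_on_conj[of F "\<lambda>w. \<not> Q e w" F "Q e'"] insert.prems(1) that
      by (simp add: depends_on_not)
    then show "c * pr (\<lambda>w. \<exists>e'\<in>T. ?Q e' w) \<le> pr (\<lambda>w. \<exists>e'\<in>T. ?Q e' w \<and> R e' w)"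
      using insert.prems by (intro insert.IH) auto
  qed
  also have "\<dots> = pr (\<lambda>w. (Q e w \<and> R e w) \<or> (\<exists>e'\<in>T. ?Q e' w \<and> R e' w))"
    by (rule pr_disj_eq[symmetric, OF _ meas(2)]) auto
  also have "\<dots> \<le> pr (\<lambda>w. \<exists>e'\<in>insert e T. Q e' w \<and> R e' w)"
    by (rule pr_mono[OF _ meas(3)]) auto
  finally show ?case .
qed simp

subsection \<open>Positive association of decreasing events\<close>

lemma pr_eq_integral_PiM:
  assumes "depends_on F Q" and [measurable]: "Measurable.pred env Q"
  shows "pr Q = (\<integral>w. of_bool (Q w) \<partial>PiM F (\<lambda>_. \<nu>))"
proof -
  have [measurable]: "Measurable.pred (PiM F (\<lambda>_. \<nu>)) Q"
    using depends_on_pred_PiM[OF assms] .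
  have restrict: "(\<lambda>w. restrict w F) \<in> measurable env (PiM F (\<lambda>_. \<nu>))"
    unfolding env_def by (rule measurable_restrict_subset) simp
  have "pr Q = (\<integral>w. indicator {w. Q w} w \<partial>env)" by (simp add: pr_def)
  also have "\<dots> = (\<integral>w. of_bool (Q (restrict w F)) \<partial>env)"
    by (simp add: depends_on_restrict[OF assms(1)] indicator_def)
  also have "\<dots> = (\<integral>w. of_bool (Q w) \<partial>distr env (PiM F (\<lambda>_. \<nu>)) (\<lambda>w. restrict w F))"
    by (rule integral_distr[symmetric, OF restrict]) measurable
  also have "distr env (PiM F (\<lambda>_. \<nu>)) (\<lambda>w. restrict w F) = PiM F (\<lambda>_. \<nu>)"
    using distr_PiM_reindex[of UNIV "\<lambda>_. \<nu>" "\<lambda>v. v" F] by (simp add: env_def prob_space_axioms)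
  finally show ?thesis .
qed

lemma harris_decreasing_on:
  assumes "finite F"
    and Q: "decreasing_on F Q" "Measurable.pred env Q"
    and R: "decreasing_on F R" "Measurable.pred env R"
  shows "pr Q * pr R \<le> pr (\<lambda>w. Q w \<and> R w)"
proof -
  have unit_antimono: "unit_antimono (PiM F (\<lambda>_. \<nu>)) (\<lambda>w. of_bool (P w))"
    if P: "decreasing_on F P" "Measurable.pred env P" for P
  proof (rule unit_antimonoI)
    have [measurable]: "Measurable.pred (PiM F (\<lambda>_. \<nu>)) P"
      using P by (intro depends_on_pred_PiM decreasing_on_imp_depends_on)
    show "(\<lambda>w. of_bool (P w) :: real) \<in> borel_measurable (PiM F (\<lambda>_. \<nu>))" by measurable
    fix w w' :: "int \<times> int \<Rightarrow> real" assume "w \<le> w'"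
    then have "P w' \<Longrightarrow> P w"
      using P(1) unfolding decreasing_on_def le_fun_def by blast
    then show "of_bool (P w') \<le> (of_bool (P w) :: real)" by simp
  qed auto
  have integral: "pr P = (\<integral>w. of_bool (P w) \<partial>PiM F (\<lambda>_. \<nu>))"
    if "decreasing_on F P" "Measurable.pred env P" for P
    using that by (intro pr_eq_integral_PiM decreasing_on_imp_depends_on)
  have "pr Q * pr R \<le> (\<integral>w. of_bool (Q w) * of_bool (R w) \<partial>PiM F (\<lambda>_. \<nu>))"
    unfolding integral[OF Q] integral[OF R]
    by (intro harris_PiM prob_space_axioms \<open>finite F\<close> unit_antimono Q R)
  also have "\<dots> = pr (\<lambda>w. Q w \<and> R w)"
    using Q R by (subst integral) (auto simp: of_bool_conj intro: decreasing_on_conj)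
  finally show ?thesis .
qed

definition decreasing_cylinder :: "((int \<times> int \<Rightarrow> real) \<Rightarrow> bool) \<Rightarrow> bool" where
  "decreasing_cylinder Q \<longleftrightarrow> Measurable.pred env Q \<and> (\<exists>F. finite F \<and> decreasing_on F Q)"

lemma decreasing_cylinder_pred:
  "decreasing_cylinder Q \<Longrightarrow> Measurable.pred env Q"
  by (simp add: decreasing_cylinder_def)

lemma decreasing_cylinder_common_support:
  assumes "decreasing_cylinder Q" "decreasing_cylinder R"
  obtains F where "finite F" "decreasing_on F Q" "decreasing_on F R"
proof -
  obtain F G where "finite F" "decreasing_on F Q" "finite G" "decreasing_on G R"
    using assms by (auto simp: decreasing_cylinder_def)
  then show ?thesis
    using that[of "F \<union> G"] decreasing_on_mono[of _ _ "F \<union> G"] by auto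
qed

lemma decreasing_cylinder_conj:
  assumes "decreasing_cylinder Q" "decreasing_cylinder R"
  shows "decreasing_cylinder (\<lambda>w. Q w \<and> R w)"
proof -
  note [measurable] = assms[THEN decreasing_cylinder_pred]
  obtain F where F: "finite F" "decreasing_on F Q" "decreasing_on F R"
    using decreasing_cylinder_common_support[OF assms] .
  note decreasing_on_conj[OF F(2,3)]
  moreover have "Measurable.pred env (\<lambda>w. Q w \<and> R w)" by measurable
  ultimately show ?thesis using F(1) unfolding decreasing_cylinder_def by blast
qed

lemma harris_conj:
  assumes "decreasing_cylinder Q" "decreasing_cylinder R"
  shows "pr Q * pr R \<le> pr (\<lambda>w. Q w \<and> R w)"
  by (rule decreasing_cylinder_common_support[OF assms])
    (intro harris_decreasing_on decreasing_cylinder_pred assms)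

lemma decreasing_cylinder_True: "decreasing_cylinder (\<lambda>w. True)"
  by (auto simp: decreasing_cylinder_def decreasing_on_def)

lemma decreasing_cylinder_Ball:
  assumes "finite T" "\<And>e. e \<in> T \<Longrightarrow> decreasing_cylinder (Q e)"
  shows "decreasing_cylinder (\<lambda>w. \<forall>e\<in>T. Q e w)"
  using assms
  by (induction T rule: finite_induct)
    (simp_all add: decreasing_cylinder_True decreasing_cylinder_conj)

lemma decreasing_cylinder_lpp_le: "decreasing_cylinder (\<lambda>w. lpp w u v \<le> t)"
proof -
  have "decreasing_on {u..v} (\<lambda>w. lpp w u v \<le> t)"
    unfolding decreasing_on_def by (meson lpp_mono order.trans)
  moreover have "Measurable.pred env (\<lambda>w. lpp w u v \<le> t)" by measurable
  ultimately show ?thesis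
    unfolding decreasing_cylinder_def using finite_interval_int_prod by blast
qed

lemma harris_Ball:
  assumes "finite T" "\<And>e. e \<in> T \<Longrightarrow> decreasing_cylinder (Q e)"
  shows "(\<Prod>e\<in>T. pr (Q e)) \<le> pr (\<lambda>w. \<forall>e\<in>T. Q e w)"
  using assms
proof (induction T rule: finite_induct)
  case (insert e T)
  have "(\<Prod>e\<in>insert e T. pr (Q e)) \<le> pr (Q e) * pr (\<lambda>w. \<forall>e\<in>T. Q e w)"
    using insert by (simp add: mult_left_mono)
  also have "\<dots> \<le> pr (\<lambda>w. Q e w \<and> (\<forall>e\<in>T. Q e w))"
    using insert by (intro harris_conj decreasing_cylinder_Ball) auto
  finally show ?case by simp
qed simp

end

section \<open>Crossings of a slab\<close>

definition pt :: "int \<Rightarrow> int \<Rightarrow> int \<times> int" where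
  "pt p x = (p - x, p + x)"

lemma pt_add_one: "pt p x + (1, 1) = pt (p + 1) x"
  by (simp add: pt_def)

lemma pt_le_iff: "pt p x \<le> pt q y \<longleftrightarrow> \<bar>y - x\<bar> \<le> q - p"
  by (auto simp: pt_def)

lemma level_pt [simp]: "level (pt p x) = 2 * p"
  by (simp add: level_def pt_def)

lemma level_eq_iff_pt: "level v = 2 * p \<longleftrightarrow> v = pt p (snd v - p)"
  by (auto simp: level_def pt_def prod_eq_iff)

definition slab :: "int \<Rightarrow> int \<Rightarrow> (int \<times> int) set" where
  "slab p q = {v. 2 * p \<le> level v \<and> level v \<le> 2 * q}"

lemma interval_pt_subset_slab: "{pt p x..pt q y} \<subseteq> slab p q"
  by (auto simp: slab_def pt_def level_def)

lemma lpp_pt_superadditive: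
  assumes "\<And>v. 0 \<le> w v" "\<bar>y - x\<bar> \<le> q - p" "\<bar>z - y\<bar> \<le> r - (q + 1)"
  shows "lpp w (pt p x) (pt q y) + lpp w (pt (q + 1) y) (pt r z) \<le> lpp w (pt p x) (pt r z)"
  using lpp_superadditive[of w "pt p x" "pt q y" "pt r z"] assms
  by (simp add: pt_add_one pt_le_iff)

lemma lpp_pt_superadditive_three:
  assumes w: "\<And>v. 0 \<le> w v" and steps: "\<bar>x - x0\<bar> \<le> p - 1 - p'" "\<bar>y - x\<bar> \<le> q - p"
    "\<bar>y0 - y\<bar> \<le> q' - (q + 1)"
  shows "lpp w (pt p' x0) (pt (p - 1) x) + lpp w (pt p x) (pt q y) + lpp w (pt (q + 1) y) (pt q' y0)
    \<le> lpp w (pt p' x0) (pt q' y0)"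
proof -
  have "lpp w (pt p x) (pt q y) + lpp w (pt (q + 1) y) (pt q' y0) \<le> lpp w (pt p x) (pt q' y0)"
    using w steps(2,3) by (rule lpp_pt_superadditive)
  moreover have "lpp w (pt p' x0) (pt (p - 1) x) + lpp w (pt p x) (pt q' y0)
      \<le> lpp w (pt p' x0) (pt q' y0)"
    using lpp_pt_superadditive[of w x x0 "p - 1" p' y0 q'] w steps by simp
  ultimately show ?thesis by linarith
qed

definition passage :: "nat \<Rightarrow> int \<Rightarrow> (int \<times> int \<Rightarrow> real) \<Rightarrow> real" where
  "passage n z w = lpp w (pt 1 0) (pt (int n) z)"

lemma Xrz_eq_passage: "Xrz \<xi> r z \<omega> = passage r z (\<lambda>v. \<xi> v \<omega>)"
  by (simp add: Xrz_def passage_def pt_def)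

lemma passage_diagonal_mono:
  assumes w: "\<And>v. 0 \<le> w v" and "1 \<le> r" "r \<le> N"
  shows "passage r 0 w \<le> passage N 0 w"
proof (cases "r = N")
  case False
  then have "passage r 0 w + lpp w (pt (int r + 1) 0) (pt (int N) 0) \<le> passage N 0 w"
    using lpp_pt_superadditive[of w 0 0 "int r" 1 0 "int N"] assms by (simp add: passage_def)
  moreover have "0 \<le> lpp w (pt (int r + 1) 0) (pt (int N) 0)"
    using assms False by (intro lpp_nonneg) (auto simp: pt_le_iff)
  ultimately show ?thesis by linarith
qed simp

definition col :: "int \<Rightarrow> int \<Rightarrow> int set" where
  "col b j = {j * b..<(j + 1) * b}"

lemma finite_col [simp]: "finite (col b j)"
  by (simp add: col_def)

lemma col_bounds: "x \<in> col b j \<Longrightarrow> 0 \<le> x - j * b \<and> x - j * b < b"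
  by (auto simp: col_def algebra_simps)

lemma mem_col_div: "0 < b \<Longrightarrow> x \<in> col b (x div b)"
  using pos_mod_bound[of b x] pos_mod_sign[of b x] div_mult_mod_eq[of x b]
  unfolding col_def atLeastLessThan_iff distrib_right by linarith

definition block_le ::
  "int \<Rightarrow> nat \<Rightarrow> int \<Rightarrow> int \<Rightarrow> int \<Rightarrow> real \<Rightarrow> (int \<times> int \<Rightarrow> real) \<Rightarrow> bool" where
  "block_le p n b j j' t w \<longleftrightarrow> (\<forall>x\<in>col b j. \<forall>y\<in>col b j'.
     \<bar>y - x\<bar> \<le> int n \<longrightarrow> lpp w (pt p x) (pt (p + int n) y) \<le> t)"

lemma block_le_mono: "block_le p n b j j' t w \<Longrightarrow> t \<le> t' \<Longrightarrow> block_le p n b j j' t' w"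
  unfolding block_le_def by (meson order.trans)

context iid_field
begin

lemma measurable_passage [measurable]: "passage n z \<in> borel_measurable env"
  unfolding passage_def[abs_def] by measurable

lemma pr_lpp_pt:
  assumes "Measurable.pred borel R" "q = p + int n - 1"
  shows "pr (\<lambda>w. R (lpp w (pt p x) (pt q y))) = pr (\<lambda>w. R (passage n (y - x) w))"
proof -
  have "pt 1 0 + (pt p x - pt 1 0) = pt p x" "pt (int n) (y - x) + (pt p x - pt 1 0) = pt q y"
    using assms(2) by (auto simp: pt_def)
  then show ?thesis
    unfolding passage_def
    using pr_lpp_shift[OF assms(1), of "pt 1 0" "pt p x - pt 1 0" "pt (int n) (y - x)"] by simp
qed

lemma pr_passage_reflect: "Measurable.pred borel R \<Longrightarrow>
    pr (\<lambda>w. R (passage n (- z) w)) = pr (\<lambda>w. R (passage n z w))"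
  using pr_lpp_swap[of R "pt 1 0" "pt (int n) z"] by (simp add: passage_def pt_def)

lemma pr_passage_le_mono:
  assumes "1 \<le> r" "r \<le> n" "t \<le> t'"
  shows "pr (\<lambda>w. passage n 0 w \<le> t) \<le> pr (\<lambda>w. passage r 0 w \<le> t')"
proof (rule pr_mono_nonneg)
  fix w :: "int \<times> int \<Rightarrow> real" assume "\<And>v. 0 \<le> w v"
  then have "passage r 0 w \<le> passage n 0 w" using assms(1,2) by (rule passage_diagonal_mono)
  also assume "passage n 0 w \<le> t"
  finally show "passage r 0 w \<le> t'" using assms(3) by simp
qed measurable

lemma decreasing_cylinder_block_le: "decreasing_cylinder (block_le p n b j j' t)"
proof -
  have "decreasing_cylinder
      (\<lambda>w. \<bar>y - x\<bar> \<le> int n \<longrightarrow> lpp w (pt p x) (pt (p + int n) y) \<le> t)" for x y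
    by (cases "\<bar>y - x\<bar> \<le> int n")
      (simp_all add: decreasing_cylinder_True decreasing_cylinder_lpp_le)
  then show ?thesis
    unfolding block_le_def[abs_def] by (intro decreasing_cylinder_Ball finite_col)
qed

lemmas measurable_block_le [measurable] = decreasing_cylinder_pred[OF decreasing_cylinder_block_le]

lemma pr_block_le_mono: "t \<le> t' \<Longrightarrow> pr (block_le p n b j j' t) \<le> pr (block_le p n b j j' t')"
  by (rule pr_mono[OF _ measurable_block_le]) (rule block_le_mono)

lemma pr_block_le_vacuous:
  assumes "0 < b" "int n + b \<le> \<bar>j' - j\<bar> * b"
  shows "pr (block_le p n b j j' t) = 1"
proof -
  have "int n < \<bar>y - x\<bar>" if "x \<in> col b j" "y \<in> col b j'" for x y
  proof -
    have "\<bar>j' - j\<bar> * b = \<bar>j' * b - j * b\<bar>"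
      using assms(1) by (simp add: abs_mult flip: left_diff_distrib)
    then show ?thesis using that[THEN col_bounds] assms(2) by linarith
  qed
  then have "block_le p n b j j' t w" for w by (force simp: block_le_def)
  then have "block_le p n b j j' t = (\<lambda>w. True)" by blast
  then show ?thesis by simp
qed

lemma heavy_crossing_extends:
  assumes "finite T"
    and steps: "\<And>x y. (x, y) \<in> T \<Longrightarrow> \<bar>x - x0\<bar> \<le> p - 1 - p'"
      "\<And>x y. (x, y) \<in> T \<Longrightarrow> \<bar>y - x\<bar> \<le> q - p"
      "\<And>x y. (x, y) \<in> T \<Longrightarrow> \<bar>y0 - y\<bar> \<le> q' - (q + 1)"
    and below: "\<And>x y. (x, y) \<in> T \<Longrightarrow> 1 - \<epsilon> \<le> pr (\<lambda>w. a \<le> lpp w (pt p' x0) (pt (p - 1) x))"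
    and above: "\<And>x y. (x, y) \<in> T \<Longrightarrow> 1 - \<epsilon> \<le> pr (\<lambda>w. a \<le> lpp w (pt (q + 1) y) (pt q' y0))"
  shows "(1 - 2 * \<epsilon>) * pr (\<lambda>w. \<exists>e\<in>T. t < lpp w (pt p (fst e)) (pt q (snd e)))
    \<le> pr (\<lambda>w. t + 2 * a < lpp w (pt p' x0) (pt q' y0))"
proof -
  define lo where "lo x w \<longleftrightarrow> a \<le> lpp w (pt p' x0) (pt (p - 1) x)" for x w
  define hi where "hi y w \<longleftrightarrow> a \<le> lpp w (pt (q + 1) y) (pt q' y0)" for y w
  let ?heavy = "\<lambda>e w. t < lpp w (pt p (fst e)) (pt q (snd e))"
  have [measurable]: "Measurable.pred env (lo x)" "Measurable.pred env (hi y)" for x y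
    unfolding lo_def hi_def by measurable
  have dep_heavy: "depends_on (slab p q) (?heavy e)" for e
    by (intro depends_on_lpp[where R = "\<lambda>s. t < s"] interval_pt_subset_slab)
  have dep_ends: "depends_on (slab p' (p - 1) \<union> slab (q + 1) q') (\<lambda>w. lo x w \<and> hi y w)" for x y
    unfolding lo_def hi_def
    by (intro depends_on_conj depends_on_lpp[where R = "\<lambda>s. a \<le> s"] interval_pt_subset_slab)
  have pr_ends: "1 - 2 * \<epsilon> \<le> pr (\<lambda>w. lo (fst e) w \<and> hi (snd e) w)" if "e \<in> T" for e
  proof -
    have "1 - \<epsilon> \<le> pr (lo (fst e))" "1 - \<epsilon> \<le> pr (hi (snd e))"
      using that below[of "fst e" "snd e"] above[of "fst e" "snd e"]
      by (simp_all add: lo_def[abs_def] hi_def[abs_def])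
    moreover have "pr (lo (fst e)) + pr (hi (snd e)) - 1 \<le> pr (\<lambda>w. lo (fst e) w \<and> hi (snd e) w)"
      by (rule pr_conj_ge) measurable
    ultimately show ?thesis by linarith
  qed
  have "(1 - 2 * \<epsilon>) * pr (\<lambda>w. \<exists>e\<in>T. ?heavy e w)
      \<le> pr (\<lambda>w. \<exists>e\<in>T. ?heavy e w \<and> lo (fst e) w \<and> hi (snd e) w)"
  proof (rule pr_Bex_indep_ge[OF \<open>finite T\<close> _ dep_heavy _ dep_ends _ pr_ends])
    show "slab p q \<inter> (slab p' (p - 1) \<union> slab (q + 1) q') = {}" by (auto simp: slab_def)
  qed auto
  also have "\<dots> \<le> pr (\<lambda>w. t + 2 * a < lpp w (pt p' x0) (pt q' y0))"
  proof (rule pr_mono_nonneg)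
    fix w :: "int \<times> int \<Rightarrow> real" assume w: "\<And>v. 0 \<le> w v"
      and "\<exists>e\<in>T. ?heavy e w \<and> lo (fst e) w \<and> hi (snd e) w"
    then obtain x y where xy: "(x, y) \<in> T" and "t < lpp w (pt p x) (pt q y)" "lo x w" "hi y w"
      by auto
    then show "t + 2 * a < lpp w (pt p' x0) (pt q' y0)"
      using lpp_pt_superadditive_three[where w = w, OF w steps[OF xy]]
      by (simp add: lo_def hi_def)
  qed measurable
  finally show ?thesis .
qed

lemma block_le_failure_extends:
  fixes s n :: nat and b j j' p :: int
  assumes tight: "\<And>z. \<bar>z\<bar> < b \<Longrightarrow> 1 - \<epsilon> \<le> pr (\<lambda>w. a \<le> passage s z w)" and b: "b \<le> int s"
  shows "(1 - 2 * \<epsilon>) * (1 - pr (block_le p n b j j' t))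
    \<le> pr (\<lambda>w. t + 2 * a < passage (n + 2 * s + 1) ((j' - j) * b) w)"
proof -
  let ?q = "p + int n"
  let ?T = "{e \<in> col b j \<times> col b j'. \<bar>snd e - fst e\<bar> \<le> int n}"
  have "(1 - 2 * \<epsilon>) * (1 - pr (block_le p n b j j' t))
      = (1 - 2 * \<epsilon>) * pr (\<lambda>w. \<not> block_le p n b j j' t w)"
    by (simp add: pr_not)
  also have "(\<lambda>w. \<not> block_le p n b j j' t w)
      = (\<lambda>w. \<exists>e\<in>?T. t < lpp w (pt p (fst e)) (pt ?q (snd e)))"
    by (auto simp: block_le_def fun_eq_iff not_le)
  also have "(1 - 2 * \<epsilon>) * pr \<dots>
      \<le> pr (\<lambda>w. t + 2 * a < lpp w (pt (p - int s) (j * b)) (pt (?q + int s) (j' * b)))"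
  proof (rule heavy_crossing_extends)
    fix x y assume xy: "(x, y) \<in> ?T"
    then have x: "\<bar>x - j * b\<bar> < b" and y: "\<bar>j' * b - y\<bar> < b" using col_bounds by force+
    then show "\<bar>x - j * b\<bar> \<le> p - 1 - (p - int s)" "\<bar>j' * b - y\<bar> \<le> ?q + int s - (?q + 1)"
      using b by auto
    show "\<bar>y - x\<bar> \<le> ?q - p" using xy by simp
    show "1 - \<epsilon> \<le> pr (\<lambda>w. a \<le> lpp w (pt (p - int s) (j * b)) (pt (p - 1) x))"
      using tight[OF x] pr_lpp_pt[of "\<lambda>u. a \<le> u" "p - 1" "p - int s" s "j * b" x] by simp
    show "1 - \<epsilon> \<le> pr (\<lambda>w. a \<le> lpp w (pt (?q + 1) y) (pt (?q + int s) (j' * b)))"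
      using tight[OF y] pr_lpp_pt[of "\<lambda>u. a \<le> u" "?q + int s" "?q + 1" s y "j' * b"] by simp
  qed simp
  also have "\<dots> = pr (\<lambda>w. t + 2 * a < passage (n + 2 * s + 1) ((j' - j) * b) w)"
    by (subst pr_lpp_pt[where n = "n + 2 * s + 1"]) (auto simp: left_diff_distrib)
  finally show ?thesis .
qed

definition upper_tail_bound ::
  "(nat \<Rightarrow> int \<Rightarrow> real) \<Rightarrow> real \<Rightarrow> real \<Rightarrow> (real \<Rightarrow> real) \<Rightarrow> bool" where
  "upper_tail_bound center \<kappa> \<theta>0 \<phi> \<longleftrightarrow> (\<forall>\<^sub>F n in sequentially. \<forall>\<theta> z.
    \<theta>0 < \<theta> \<and> \<bar>real_of_int z\<bar> \<le> \<kappa> * real n \<longrightarrow>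
    pr (\<lambda>w. passage n z w - center n z > \<theta> * root 3 (real n)) \<le> \<phi> \<theta>)"

definition lower_tail_bound ::
  "(nat \<Rightarrow> int \<Rightarrow> real) \<Rightarrow> real \<Rightarrow> real \<Rightarrow> (real \<Rightarrow> real) \<Rightarrow> bool" where
  "lower_tail_bound center \<kappa> \<theta>0 \<psi> \<longleftrightarrow> (\<forall>\<^sub>F n in sequentially. \<forall>\<theta> z.
    \<theta>0 < \<theta> \<and> \<bar>real_of_int z\<bar> \<le> \<kappa> * real n \<longrightarrow>
    pr (\<lambda>w. passage n z w - center n z < - \<theta> * root 3 (real n)) \<le> \<psi> \<theta>)"

end

section \<open>The cost of a low block\<close>

lemma passage_double_superadditive:
  assumes "\<And>v. 0 \<le> w v" "\<bar>z\<bar> < int n"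
  shows "passage n z w + lpp w (pt (int n + 1) z) (pt (2 * int n) 0) \<le> passage (2 * n) 0 w"
  using lpp_pt_superadditive[of w z 0 "int n" 1 0 "2 * int n"] assms by (simp add: passage_def)

definition block_width :: "nat \<Rightarrow> int" where
  "block_width s = \<lfloor>(root 3 (real s))\<^sup>2\<rfloor>"

lemma block_width_bounds:
  assumes "1 \<le> s"
  shows "1 \<le> block_width s" "real_of_int (block_width s) \<le> (root 3 (real s))\<^sup>2"
    "(root 3 (real s))\<^sup>2 / 2 \<le> real_of_int (block_width s)" "block_width s \<le> int s"
proof -
  let ?\<sigma> = "root 3 (real s)"
  have \<sigma>: "1 \<le> ?\<sigma>" using assms by simp
  then have "1 \<le> ?\<sigma>\<^sup>2" by simp
  then show width_ge: "1 \<le> block_width s" by (simp add: block_width_def)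
  show "real_of_int (block_width s) \<le> ?\<sigma>\<^sup>2" by (simp add: block_width_def)
  also have "?\<sigma>\<^sup>2 \<le> ?\<sigma> ^ 3" using \<sigma> by (intro power_increasing) auto
  finally have "real_of_int (block_width s) \<le> real s" by simp
  then show "block_width s \<le> int s" by linarith
  have "?\<sigma>\<^sup>2 < real_of_int (block_width s) + 1" unfolding block_width_def by linarith
  with width_ge show "?\<sigma>\<^sup>2 / 2 \<le> real_of_int (block_width s)" by linarith
qed

lemma column_displacement_curvature:
  fixes s N :: nat and Q G :: real and d :: int
  assumes "1 \<le> s" "0 < N" "real N \<le> Q * real s" "0 \<le> G" "0 < Q"
  shows "G / (4 * Q) * (real_of_int d)\<^sup>2 * root 3 (real s)
    \<le> G * (real_of_int (d * block_width s))\<^sup>2 / real N"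
proof -
  define \<sigma> where "\<sigma> = root 3 (real s)"
  have "1 \<le> \<sigma>" and s: "real s = \<sigma> ^ 3" using assms(1) by (simp_all add: \<sigma>_def)
  have "(real_of_int d)\<^sup>2 * (\<sigma>\<^sup>2 / 2)\<^sup>2 \<le> (real_of_int d)\<^sup>2 * (real_of_int (block_width s))\<^sup>2"
    using block_width_bounds(3)[OF assms(1)] by (intro mult_left_mono power_mono) (auto simp: \<sigma>_def)
  also have "\<dots> = (real_of_int (d * block_width s))\<^sup>2" by (simp add: power_mult_distrib)
  finally have "G * ((real_of_int d)\<^sup>2 * (\<sigma>\<^sup>2 / 2)\<^sup>2) / (Q * \<sigma> ^ 3)
      \<le> G * (real_of_int (d * block_width s))\<^sup>2 / real N"
    using assms(2-4) s by (intro frac_le mult_left_mono mult_nonneg_nonneg) auto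
  moreover have "G * ((real_of_int d)\<^sup>2 * (\<sigma>\<^sup>2 / 2)\<^sup>2) / (Q * \<sigma> ^ 3)
      = G / (4 * Q) * (real_of_int d)\<^sup>2 * \<sigma>"
    using \<open>0 < Q\<close> \<open>1 \<le> \<sigma>\<close> by (simp add: field_simps power2_eq_square power3_eq_cube)
  ultimately show ?thesis by (simp add: \<sigma>_def)
qed

lemma exp_minus_double_le: "0 \<le> q \<Longrightarrow> q \<le> 1 / 2 \<Longrightarrow> exp (- (2 * q)) \<le> 1 - q" for q :: real
proof -
  assume q: "0 \<le> q" "q \<le> 1 / 2"
  have "(1 - q) * (1 + 2 * q) = 1 + q * (1 - 2 * q)" by (simp add: algebra_simps)
  then have "1 \<le> (1 - q) * (1 + 2 * q)" using q by simp
  also have "\<dots> \<le> (1 - q) * exp (2 * q)" using q by (intro mult_left_mono) auto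
  finally show ?thesis by (simp add: exp_minus divide_le_eq inverse_eq_divide)
qed

locale lpp_fluctuations = iid_field +
  fixes \<mu> \<delta> C \<kappa> G \<theta>0 :: real and \<phi> :: "real \<Rightarrow> real"
  assumes delta_pos: "0 < \<delta>" and C_pos: "0 < C" and kappa_pos: "0 < \<kappa>" and G_pos: "0 < G"
    and theta0_nonneg: "0 \<le> \<theta>0"
    and tail_decay: "((\<lambda>\<theta>. \<theta> ^ 4 * \<phi> \<theta>) \<longlongrightarrow> 0) at_top"
    and low_passage: "\<forall>\<^sub>F n in sequentially.
      \<delta> \<le> pr (\<lambda>w. passage n 0 w < \<mu> * real n - C * root 3 (real n))"
    and lower_tight: "0 < \<epsilon> \<Longrightarrow> \<exists>D>0. \<forall>\<^sub>F n in sequentially.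
      \<forall>z. \<bar>real_of_int z\<bar> \<le> (root 3 (real n))\<^sup>2 \<longrightarrow>
        1 - \<epsilon> \<le> pr (\<lambda>w. \<mu> * real n - D * root 3 (real n) \<le> passage n z w)"
    and upper_tail:
      "upper_tail_bound (\<lambda>n z. \<mu> * real n - G * (real_of_int z)\<^sup>2 / real n) \<kappa> \<theta>0 \<phi>"
begin

lemma delta_le_1: "\<delta> \<le> 1"
  using eventually_happens'[OF sequentially_bot low_passage] pr_le_1 by (meson order.trans)

text \<open>Reflection: disjoint copies of \<open>X\<^sub>n\<^sup>z\<close> and \<open>X\<^sub>n\<^sup>-\<^sup>z\<close> sit inside \<open>X\<^sub>2\<^sub>n\<^sup>0\<close>.\<close>

lemma low_passage_all_directions:
  "\<forall>\<^sub>F n in sequentially. \<forall>z. \<bar>z\<bar> < int n \<longrightarrow>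
    \<delta> / 2 \<le> pr (\<lambda>w. passage n z w < \<mu> * real n - C / 2 * root 3 (real n))"
proof -
  have "strict_mono (\<lambda>n::nat. 2 * n)" by (simp add: strict_mono_def)
  from eventually_subseq[OF this low_passage] show ?thesis
  proof (rule eventually_mono, intro allI impI)
    fix n :: nat and z :: int
    assume low: "\<delta> \<le> pr (\<lambda>w. passage (2 * n) 0 w
      < \<mu> * real (2 * n) - C * root 3 (real (2 * n)))" and z: "\<bar>z\<bar> < int n"
    let ?t = "\<mu> * real n - C / 2 * root 3 (real n)"
    let ?upper = "\<lambda>w. lpp w (pt (int n + 1) z) (pt (2 * int n) 0)"
    have "C * root 3 (real n) \<le> C * root 3 (real (2 * n))"
      using C_pos by (intro mult_left_mono) auto
    then have "\<mu> * real (2 * n) - C * root 3 (real (2 * n)) \<le> 2 * ?t"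
      by (simp add: algebra_simps)
    then have "pr (\<lambda>w. passage (2 * n) 0 w < \<mu> * real (2 * n) - C * root 3 (real (2 * n)))
        \<le> pr (\<lambda>w. passage n z w < ?t \<or> ?upper w < ?t)"
      using passage_double_superadditive[OF _ z] by (intro pr_mono_nonneg) (smt (verit), measurable)
    also have "\<dots> \<le> pr (\<lambda>w. passage n z w < ?t) + pr (\<lambda>w. ?upper w < ?t)"
      by (rule pr_disj_le) measurable
    also have "pr (\<lambda>w. ?upper w < ?t) = pr (\<lambda>w. passage n (0 - z) w < ?t)"
      by (rule pr_lpp_pt) auto
    also have "\<dots> = pr (\<lambda>w. passage n z w < ?t)"
      using pr_passage_reflect[of "\<lambda>u. u < ?t"] by simp
    finally show "\<delta> / 2 \<le> pr (\<lambda>w. passage n z w < ?t)" using low by simp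
  qed
qed

abbreviation low_block ::
  "nat \<Rightarrow> nat \<Rightarrow> int \<Rightarrow> int \<Rightarrow> int \<Rightarrow> real \<Rightarrow> (int \<times> int \<Rightarrow> real) \<Rightarrow> bool" where
  "low_block m s p j j' \<tau> \<equiv>
    block_le p (m * s) (block_width s) j j' (\<mu> * real (m * s) + \<tau> * root 3 (real s))"

lemma low_block_failure_extends:
  assumes "1 \<le> s" "s \<le> S"
    and tight: "\<forall>z. \<bar>real_of_int z\<bar> \<le> (root 3 (real S))\<^sup>2 \<longrightarrow> 1 - \<epsilon> \<le> pr (\<lambda>w. a \<le> passage S z w)"
    and level: "u \<le> \<mu> * real (m * s) + \<tau> * root 3 (real s) + 2 * a"
  shows "(1 - 2 * \<epsilon>) * (1 - pr (low_block m s p j j' \<tau>))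
    \<le> pr (\<lambda>w. u < passage (m * s + 2 * S + 1) ((j' - j) * block_width s) w)"
proof -
  have "(root 3 (real s))\<^sup>2 \<le> (root 3 (real S))\<^sup>2"
    using assms(2) by (intro power_mono) auto
  then have "1 - \<epsilon> \<le> pr (\<lambda>w. a \<le> passage S z w)" if "\<bar>z\<bar> < block_width s" for z
    using that block_width_bounds(2)[OF assms(1)] by (intro tight[rule_format]) linarith
  moreover have "block_width s \<le> int S" using block_width_bounds(4)[OF assms(1)] assms(2) by simp
  ultimately have "(1 - 2 * \<epsilon>) * (1 - pr (low_block m s p j j' \<tau>))
    \<le> pr (\<lambda>w. \<mu> * real (m * s) + \<tau> * root 3 (real s) + 2 * a
        < passage (m * s + 2 * S + 1) ((j' - j) * block_width s) w)"
    by (rule block_le_failure_extends)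
  also have "\<dots> \<le> pr (\<lambda>w. u < passage (m * s + 2 * S + 1) ((j' - j) * block_width s) w)"
    using level by (intro pr_mono) auto
  finally show ?thesis .
qed

lemma low_block_displacement:
  assumes "1 \<le> s" "pr (low_block m s p j j' \<tau>) \<noteq> 1"
  shows "\<bar>(j' - j) * block_width s\<bar> < int ((m + 1) * s)"
proof (rule ccontr)
  note width = block_width_bounds(1,4)[OF assms(1)]
  have "\<bar>(j' - j) * block_width s\<bar> = \<bar>j' - j\<bar> * block_width s" using width by (simp add: abs_mult)
  moreover assume "\<not> ?thesis"
  ultimately have "int (m * s) + block_width s \<le> \<bar>j' - j\<bar> * block_width s"
    using width by (simp add: distrib_right)
  then show False using pr_block_le_vacuous width assms(2) by force
qed

lemma low_block_pr_ge:
  fixes m s :: nat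
  defines "N \<equiv> m * s + 2 * s + 1"
  assumes "1 \<le> s"
    and tight: "\<forall>z. \<bar>real_of_int z\<bar> \<le> (root 3 (real s))\<^sup>2 \<longrightarrow> 1 - \<delta> / 8 \<le> pr (\<lambda>w. a \<le> passage s z w)"
    and low: "\<forall>z. \<bar>z\<bar> < int N \<longrightarrow> \<delta> / 2 \<le> pr (\<lambda>w. passage N z w < u)"
    and level: "u \<le> \<mu> * real (m * s) + \<tau> * root 3 (real s) + 2 * a"
  shows "\<delta> / 4 \<le> pr (low_block m s p j j' \<tau>)"
proof (cases "pr (low_block m s p j j' \<tau>) = 1")
  case False
  let ?z = "(j' - j) * block_width s"
  have "\<bar>?z\<bar> < int N"
    using low_block_displacement[OF \<open>1 \<le> s\<close> False] by (simp add: N_def algebra_simps)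
  then have "\<delta> / 2 \<le> pr (\<lambda>w. passage N ?z w < u)" using low by simp
  moreover have "(1 - 2 * (\<delta> / 8)) * (1 - pr (low_block m s p j j' \<tau>))
      \<le> pr (\<lambda>w. u < passage N ?z w)"
    unfolding N_def using \<open>1 \<le> s\<close> order_refl tight level by (rule low_block_failure_extends)
  moreover have "\<dots> \<le> pr (\<lambda>w. \<not> passage N ?z w < u)" by (rule pr_mono) auto
  moreover have "\<dots> = 1 - pr (\<lambda>w. passage N ?z w < u)" by (rule pr_not) measurable
  moreover have "1 - \<delta> / 2 \<le> (1 - 2 * (\<delta> / 8)) * (1 - \<delta> / 4)" by (simp add: algebra_simps)
  ultimately have "(1 - 2 * (\<delta> / 8)) * (1 - pr (low_block m s p j j' \<tau>))
      \<le> (1 - 2 * (\<delta> / 8)) * (1 - \<delta> / 4)" by linarith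
  then show ?thesis using delta_le_1 by (subst (asm) mult_le_cancel_left_pos) auto
qed (use delta_le_1 in simp)

lemma low_block_pr_positive:
  "\<exists>m\<ge>1. \<exists>\<delta>'>0. \<forall>\<^sub>F s in sequentially. \<forall>p j j'. \<delta>' \<le> pr (low_block m s p j j' (- 1))"
proof -
  obtain D where "0 < D" and tight: "\<forall>\<^sub>F n in sequentially.
      \<forall>z. \<bar>real_of_int z\<bar> \<le> (root 3 (real n))\<^sup>2 \<longrightarrow>
        1 - \<delta> / 8 \<le> pr (\<lambda>w. \<mu> * real n - D * root 3 (real n) \<le> passage n z w)"
    using lower_tight[of "\<delta> / 8"] delta_pos by auto
  define B where "B = 2 * (\<bar>\<mu>\<bar> + 1 + 2 * D) / C"
  have "0 < B" using C_pos \<open>0 < D\<close> by (simp add: B_def)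
  obtain m :: nat where m: "B ^ 3 \<le> real m" using real_arch_simple by blast
  have "1 \<le> m" using m zero_less_power[OF \<open>0 < B\<close>, of 3] by (cases m) auto
  have "B = root 3 (B ^ 3)" by (simp add: odd_real_root_power_cancel)
  also have "\<dots> \<le> root 3 (real m)" using m by simp
  finally have "B \<le> root 3 (real m)" .
  have "strict_mono (\<lambda>s. m * s + 2 * s + 1)" by (simp add: strict_mono_def add_le_less_mono)
  from eventually_subseq[OF this low_passage_all_directions] tight eventually_ge_at_top[of 1]
  have "\<forall>\<^sub>F s in sequentially. \<forall>p j j'. \<delta> / 4 \<le> pr (low_block m s p j j' (- 1))"
  proof eventually_elim
    case (elim s)
    show ?case
    proof (intro allI, rule low_block_pr_ge[OF elim(3,2,1)])
      define \<sigma> where "\<sigma> = root 3 (real s)"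
      have "1 \<le> \<sigma>" using elim(3) by (simp add: \<sigma>_def)
      have "(\<bar>\<mu>\<bar> + 1 + 2 * D) * \<sigma> = C / 2 * (B * \<sigma>)" using C_pos by (simp add: B_def)
      also have "\<dots> \<le> C / 2 * (root 3 (real m) * \<sigma>)"
        using C_pos \<open>B \<le> root 3 (real m)\<close> \<open>1 \<le> \<sigma>\<close> by (intro mult_left_mono mult_right_mono) auto
      also have "\<dots> = C / 2 * root 3 (real (m * s))" by (simp add: \<sigma>_def real_root_mult)
      also have "\<dots> \<le> C / 2 * root 3 (real (m * s + 2 * s + 1))"
        using C_pos by (intro mult_left_mono) auto
      finally have "(\<bar>\<mu>\<bar> + 1 + 2 * D) * \<sigma> \<le> C / 2 * root 3 (real (m * s + 2 * s + 1))" .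
      moreover have "\<mu> \<le> \<bar>\<mu>\<bar> * \<sigma>" using \<open>1 \<le> \<sigma>\<close> mult_left_mono[of 1 \<sigma> "\<bar>\<mu>\<bar>"] by simp
      ultimately show "\<mu> * real (m * s + 2 * s + 1) - C / 2 * root 3 (real (m * s + 2 * s + 1))
          \<le> \<mu> * real (m * s) + - 1 * root 3 (real s) + 2 * (\<mu> * real s - D * root 3 (real s))"
        by (simp add: \<sigma>_def algebra_simps)
    qed
  qed
  then show ?thesis using \<open>1 \<le> m\<close> delta_pos by (intro exI[of _ m] conjI exI[of _ "\<delta> / 4"]) auto
qed

lemma low_block_failure_le:
  fixes m M s :: nat and D \<theta> :: real and p j j' :: int
  defines "Q \<equiv> real (m + 2 * M + 1)" and "N \<equiv> m * s + 2 * (M * s) + 1"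
  assumes "1 \<le> s" "1 \<le> M" and M: "real m + 1 \<le> \<kappa> * real M" and "\<theta>0 < \<theta>"
    and tight: "\<forall>z. \<bar>real_of_int z\<bar> \<le> (root 3 (real (M * s)))\<^sup>2 \<longrightarrow>
        3 / 4 \<le> pr (\<lambda>w. \<mu> * real (M * s) - D * root 3 (real (M * s)) \<le> passage (M * s) z w)"
    and tail: "\<forall>\<theta> z. \<theta>0 < \<theta> \<and> \<bar>real_of_int z\<bar> \<le> \<kappa> * real N \<longrightarrow>
        pr (\<lambda>w. passage N z w - (\<mu> * real N - G * (real_of_int z)\<^sup>2 / real N)
          > \<theta> * root 3 (real N)) \<le> \<phi> \<theta>"
  shows "1 - pr (low_block m s p j j'
      (\<bar>\<mu>\<bar> + 2 * D * root 3 (real M) + root 3 Q * \<theta> - G / (4 * Q) * (real_of_int (j' - j))\<^sup>2))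
    \<le> 2 * \<phi> \<theta>" (is "1 - pr (low_block m s p j j' ?\<tau>) \<le> _")
proof (cases "pr (low_block m s p j j' ?\<tau>) = 1")
  case False
  define \<sigma> where "\<sigma> = root 3 (real s)"
  define d where "d = real_of_int (j' - j)"
  let ?z = "(j' - j) * block_width s"
  let ?u = "\<mu> * real N - G * (real_of_int ?z)\<^sup>2 / real N + \<theta> * root 3 (real N)"
  have "1 \<le> \<sigma>" using \<open>1 \<le> s\<close> by (simp add: \<sigma>_def)
  have "1 \<le> Q" by (simp add: Q_def)
  have "0 < N" by (simp add: N_def)
  have N_le: "real N \<le> Q * real s" using \<open>1 \<le> s\<close> by (simp add: N_def Q_def algebra_simps)
  have "\<bar>real_of_int ?z\<bar> \<le> real ((m + 1) * s)"
    using low_block_displacement[OF \<open>1 \<le> s\<close> False] by linarith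
  also have "\<dots> = (real m + 1) * real s" by (simp add: algebra_simps)
  also have "\<dots> \<le> \<kappa> * real M * real s" using M by (intro mult_right_mono) auto
  also have "\<dots> \<le> \<kappa> * real N" using kappa_pos by (simp add: N_def)
  finally have z_le: "\<bar>real_of_int ?z\<bar> \<le> \<kappa> * real N" .
  have curvature: "G / (4 * Q) * d\<^sup>2 * \<sigma> \<le> G * (real_of_int ?z)\<^sup>2 / real N"
    using column_displacement_curvature[of s N Q G "j' - j"] \<open>1 \<le> s\<close> \<open>0 < N\<close> N_le G_pos \<open>1 \<le> Q\<close>
    by (simp add: d_def \<sigma>_def)
  have "root 3 (real N) \<le> root 3 (Q * real s)" using N_le by simp
  also have "\<dots> = root 3 Q * \<sigma>" by (simp add: real_root_mult \<sigma>_def)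
  finally have fluctuation: "\<theta> * root 3 (real N) \<le> \<theta> * (root 3 Q * \<sigma>)"
    using \<open>\<theta>0 < \<theta>\<close> theta0_nonneg by (intro mult_left_mono) auto
  have "\<mu> \<le> \<bar>\<mu>\<bar> * \<sigma>" using \<open>1 \<le> \<sigma>\<close> mult_left_mono[of 1 \<sigma> "\<bar>\<mu>\<bar>"] by simp
  with curvature fluctuation have "?u \<le> \<mu> * real (m * s) + ?\<tau> * root 3 (real s)
      + 2 * (\<mu> * real (M * s) - D * root 3 (real (M * s)))"
    by (simp add: N_def real_root_mult d_def \<sigma>_def algebra_simps)
  then have "(1 - 2 * (1 / 4)) * (1 - pr (low_block m s p j j' ?\<tau>)) \<le> pr (\<lambda>w. ?u < passage N ?z w)"
    unfolding N_def using \<open>1 \<le> s\<close> \<open>1 \<le> M\<close> tight by (intro low_block_failure_extends) auto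
  also have "\<dots> = pr (\<lambda>w. passage N ?z w - (\<mu> * real N - G * (real_of_int ?z)\<^sup>2 / real N)
      > \<theta> * root 3 (real N))"
    by (simp add: less_diff_eq add.commute)
  also have "\<dots> \<le> \<phi> \<theta>" using tail z_le \<open>\<theta>0 < \<theta>\<close> by blast
  finally show ?thesis by simp
next
  case True
  have "0 \<le> \<phi> \<theta>"
    using tail[rule_format, of \<theta> 0] kappa_pos \<open>\<theta>0 < \<theta>\<close> by (auto intro: order.trans[OF pr_nonneg])
  with True show ?thesis by simp
qed

lemma low_block_upper_tail:
  "\<exists>K K' G'. 0 < K' \<and> 0 < G' \<and> (\<forall>\<^sub>F s in sequentially. \<forall>p j j' \<theta>. \<theta>0 < \<theta> \<longrightarrow>
    1 - 2 * \<phi> \<theta> \<le> pr (low_block m s p j j' (K + K' * \<theta> - G' * (real_of_int (j' - j))\<^sup>2)))"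
proof -
  obtain D where tight: "\<forall>\<^sub>F n in sequentially.
      \<forall>z. \<bar>real_of_int z\<bar> \<le> (root 3 (real n))\<^sup>2 \<longrightarrow>
        1 - 1 / 4 \<le> pr (\<lambda>w. \<mu> * real n - D * root 3 (real n) \<le> passage n z w)"
    using lower_tight[of "1 / 4"] by auto
  obtain M :: nat where "(real m + 1) / \<kappa> \<le> real M" using real_arch_simple by blast
  then have M: "real m + 1 \<le> \<kappa> * real M" using kappa_pos by (simp add: divide_le_eq mult.commute)
  then have "1 \<le> M" using kappa_pos by (cases M) auto
  define Q where "Q = real (m + 2 * M + 1)"
  have "strict_mono (\<lambda>s. M * s)" "strict_mono (\<lambda>s. m * s + 2 * (M * s) + 1)"
    using \<open>1 \<le> M\<close> by (simp_all add: strict_mono_def add_le_less_mono)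
  from eventually_subseq[OF this(1) tight]
    eventually_subseq[OF this(2) upper_tail[unfolded upper_tail_bound_def]]
    eventually_ge_at_top[of 1]
  have "\<forall>\<^sub>F s in sequentially. \<forall>p j j' \<theta>. \<theta>0 < \<theta> \<longrightarrow> 1 - 2 * \<phi> \<theta> \<le> pr (low_block m s p j j'
      (\<bar>\<mu>\<bar> + 2 * D * root 3 (real M) + root 3 Q * \<theta> - G / (4 * Q) * (real_of_int (j' - j))\<^sup>2))"
  proof eventually_elim
    case (elim s)
    show ?case
    proof (intro allI impI)
      fix p j j' \<theta> assume "\<theta>0 < \<theta>"
      show "1 - 2 * \<phi> \<theta> \<le> pr (low_block m s p j j'
          (\<bar>\<mu>\<bar> + 2 * D * root 3 (real M) + root 3 Q * \<theta> - G / (4 * Q) * (real_of_int (j' - j))\<^sup>2))"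
        using low_block_failure_le[OF elim(3) \<open>1 \<le> M\<close> M \<open>\<theta>0 < \<theta>\<close>, of D p j j'] elim(1,2)
        unfolding Q_def by simp
    qed
  qed
  moreover have "0 < root 3 Q" "0 < G / (4 * Q)" using G_pos by (simp_all add: Q_def)
  ultimately show ?thesis by blast
qed

end

lemma displacement_le_excess:
  fixes d f g G :: real
  assumes "0 \<le> d" "0 < G" "g \<le> 1"
  shows "d + 2 * g * f \<le> - 1 / 2 - g * d + 2 * g * f + G * d\<^sup>2 + (1 / G + 1 / 2)"
proof -
  have "0 \<le> (G * d - 1)\<^sup>2 / G" using assms(2) by simp
  also have "\<dots> = G * d\<^sup>2 - 2 * d + 1 / G" using assms(2) by (simp add: field_simps power2_eq_square)
  finally have "2 * d \<le> G * d\<^sup>2 + 1 / G" by simp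
  moreover have "g * d \<le> d" using assms(1,3) mult_right_mono[of g 1 d] by simp
  ultimately show ?thesis by linarith
qed

lemma displacement_product_le_excess:
  fixes d f g G :: real
  defines "y \<equiv> - 1 / 2 - g * d + 2 * g * f + G * d\<^sup>2" and "J \<equiv> 1 / G + 1 / 2"
  assumes "0 \<le> d" "0 \<le> f" "0 < G" "0 < g" "g \<le> 1"
  shows "(1 + d)\<^sup>2 * (1 + f)\<^sup>2 \<le> ((1 + J) * (1 + (1 + J) / (2 * g)))\<^sup>2 * (1 + \<bar>y\<bar>) ^ 4"
proof -
  have "0 < J" using \<open>0 < G\<close> by (simp add: J_def add_pos_pos)
  have sum_le: "d + 2 * g * f \<le> \<bar>y\<bar> + J"
    using displacement_le_excess[of d G g f] assms(3,5,7) by (simp add: y_def J_def)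
  have "0 \<le> J * \<bar>y\<bar>" using \<open>0 < J\<close> by simp
  moreover have "0 \<le> g * f" using assms(4,6) by simp
  ultimately have "1 + d \<le> (1 + J) * (1 + \<bar>y\<bar>)" using sum_le by (simp add: algebra_simps)
  have "2 * g * f \<le> (1 + J) * (1 + \<bar>y\<bar>)"
    using sum_le \<open>0 \<le> d\<close> \<open>0 \<le> J * \<bar>y\<bar>\<close> by (simp add: algebra_simps)
  then have "f \<le> (1 + J) / (2 * g) * (1 + \<bar>y\<bar>)" using \<open>0 < g\<close> by (simp add: field_simps)
  then have "1 + f \<le> (1 + (1 + J) / (2 * g)) * (1 + \<bar>y\<bar>)" by (simp add: distrib_right)
  with \<open>1 + d \<le> _\<close> have "((1 + d) * (1 + f))\<^sup>2
      \<le> ((1 + J) * (1 + \<bar>y\<bar>) * ((1 + (1 + J) / (2 * g)) * (1 + \<bar>y\<bar>)))\<^sup>2"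
    using assms(3,4) \<open>0 < J\<close> by (intro power_mono mult_mono) auto
  then show ?thesis by (simp add: power_mult_distrib power2_eq_square power4_eq_xxxx mult_ac)
qed

definition block_level :: "real \<Rightarrow> nat \<Rightarrow> int \<Rightarrow> int \<Rightarrow> real" where
  "block_level g k j j' = - 1 / 2 - g * \<bar>real_of_int (j' - j)\<bar> + 2 * g * (\<bar>real_of_int j\<bar> / real k)"

definition block_weight :: "nat \<Rightarrow> int \<Rightarrow> int \<Rightarrow> real" where
  "block_weight k j j' = 1 / ((1 + \<bar>real_of_int (j' - j)\<bar>)\<^sup>2 * (1 + \<bar>real_of_int j\<bar> / real k)\<^sup>2)"

lemma block_level_ge_or_excess_ge:
  fixes g G y0 :: real
  assumes "0 < G" "0 < g" "g \<le> 1" and g: "g * (y0 + 1 / G + 1 / 2) \<le> 1 / 2"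
  shows "- 1 \<le> block_level g k j j' \<or>
    y0 \<le> block_level g k j j' + G * (real_of_int (j' - j))\<^sup>2"
proof -
  define d where "d = \<bar>real_of_int (j' - j)\<bar>"
  define f where "f = \<bar>real_of_int j\<bar> / real k"
  have level: "block_level g k j j' = - 1 / 2 - g * d + 2 * g * f"
    by (simp add: block_level_def d_def f_def)
  have "0 \<le> g * f" using \<open>0 < g\<close> by (simp add: f_def)
  show ?thesis
  proof (cases "g * d \<le> 1 / 2")
    case True
    then show ?thesis using \<open>0 \<le> g * f\<close> by (simp add: level)
  next
    case False
    with g have "g * (y0 + 1 / G + 1 / 2) \<le> g * d" by linarith
    then have "y0 + 1 / G + 1 / 2 \<le> d" using \<open>0 < g\<close> by simp
    moreover have "d + 2 * g * f \<le> block_level g k j j' + G * d\<^sup>2 + (1 / G + 1 / 2)"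
      unfolding level using assms(1,3) by (intro displacement_le_excess) (simp_all add: d_def)
    ultimately have "y0 \<le> block_level g k j j' + G * d\<^sup>2" using \<open>0 \<le> g * f\<close> by linarith
    then show ?thesis by (simp add: d_def)
  qed
qed

lemma inverse_excess_le_block_weight:
  fixes g G :: real
  assumes "0 < G" "0 < g" "g \<le> 1"
  obtains B where "0 < B" "\<And>k j j'.
    1 / (1 + \<bar>block_level g k j j' + G * (real_of_int (j' - j))\<^sup>2\<bar>) ^ 4 \<le> B * block_weight k j j'"
proof
  define J where "J = 1 / G + 1 / 2"
  define B where "B = ((1 + J) * (1 + (1 + J) / (2 * g)))\<^sup>2"
  have "0 < J" using \<open>0 < G\<close> by (simp add: J_def add_pos_pos)
  then have "0 < 1 + (1 + J) / (2 * g)" using \<open>0 < g\<close> by (intro add_pos_pos divide_pos_pos) auto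
  then show "0 < B" using \<open>0 < J\<close> unfolding B_def by (intro zero_less_power mult_pos_pos) auto
  fix k j j'
  define d where "d = \<bar>real_of_int (j' - j)\<bar>"
  define f where "f = \<bar>real_of_int j\<bar> / real k"
  define y where "y = block_level g k j j' + G * (real_of_int (j' - j))\<^sup>2"
  have "0 \<le> d" "0 \<le> f" by (simp_all add: d_def f_def)
  have y: "y = - 1 / 2 - g * d + 2 * g * f + G * d\<^sup>2"
    by (simp add: y_def block_level_def d_def f_def)
  have "(1 + d)\<^sup>2 * (1 + f)\<^sup>2 \<le> B * (1 + \<bar>y\<bar>) ^ 4"
    unfolding B_def J_def y using \<open>0 \<le> d\<close> \<open>0 \<le> f\<close> assms by (rule displacement_product_le_excess)
  moreover have "0 < (1 + d)\<^sup>2 * (1 + f)\<^sup>2" using \<open>0 \<le> d\<close> \<open>0 \<le> f\<close> by (simp add: add_pos_nonneg)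
  ultimately have "1 / (1 + \<bar>y\<bar>) ^ 4 \<le> B / ((1 + d)\<^sup>2 * (1 + f)\<^sup>2)"
    by (simp add: divide_le_eq le_divide_eq mult.commute)
  then show "1 / (1 + \<bar>block_level g k j j' + G * (real_of_int (j' - j))\<^sup>2\<bar>) ^ 4
      \<le> B * block_weight k j j'"
    by (simp add: block_weight_def y_def d_def f_def)
qed

lemma exp_quartic_le_one_minus:
  fixes A q y :: real
  assumes "1 \<le> A" "0 \<le> y" and q: "4 * q * (1 + y) ^ 4 \<le> 1"
  shows "exp (- (A / (1 + \<bar>y\<bar>) ^ 4)) \<le> 1 - 2 * q"
proof -
  define Y where "Y = (1 + y) ^ 4"
  have "1 \<le> Y" using \<open>0 \<le> y\<close> by (simp add: Y_def)
  have "A / (1 + \<bar>y\<bar>) ^ 4 \<ge> 1 / Y"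
    using assms(1,2) \<open>1 \<le> Y\<close> by (simp add: Y_def divide_right_mono)
  then have "exp (- (A / (1 + \<bar>y\<bar>) ^ 4)) \<le> exp (- (2 * (1 / (2 * Y))))" by simp
  also have "\<dots> \<le> 1 - 1 / (2 * Y)" using \<open>1 \<le> Y\<close> by (intro exp_minus_double_le frac_le) auto
  also have "\<dots> \<le> 1 - 2 * q" using q[folded Y_def] \<open>1 \<le> Y\<close> by (simp add: le_divide_eq mult_ac)
  finally show ?thesis .
qed

lemma exp_quartic_le_const:
  fixes A \<delta> y y0 :: real
  assumes "0 < \<delta>" "\<bar>y\<bar> \<le> y0" and A: "\<bar>ln \<delta>\<bar> * (1 + y0) ^ 4 \<le> A"
  shows "exp (- (A / (1 + \<bar>y\<bar>) ^ 4)) \<le> \<delta>"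
proof -
  have "\<bar>ln \<delta>\<bar> * (1 + \<bar>y\<bar>) ^ 4 \<le> \<bar>ln \<delta>\<bar> * (1 + y0) ^ 4"
    using assms(2) by (intro mult_left_mono power_mono) auto
  moreover have "0 < (1 + \<bar>y\<bar>) ^ 4" by (intro zero_less_power) simp
  ultimately have "\<bar>ln \<delta>\<bar> \<le> A / (1 + \<bar>y\<bar>) ^ 4" using A by (simp only: pos_le_divide_eq)
  then have "exp (- (A / (1 + \<bar>y\<bar>) ^ 4)) \<le> exp (ln \<delta>)" by simp
  then show ?thesis using \<open>0 < \<delta>\<close> by simp
qed

context lpp_fluctuations
begin

lemma tail_negligible:
  assumes "0 < K'"
  shows "\<forall>\<^sub>F y in at_top. \<theta>0 < (y - K) / K' \<and> 4 * \<phi> ((y - K) / K') * (1 + y) ^ 4 \<le> 1"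
proof -
  have affine: "filterlim (\<lambda>y. (y - K) / K') at_top at_top" using assms by real_asymp
  have "((\<lambda>y. ((1 + y) / ((y - K) / K')) ^ 4) \<longlongrightarrow> K' ^ 4) at_top" using assms by real_asymp
  from tendsto_mult[OF filterlim_compose[OF tail_decay affine] this]
  have "((\<lambda>y. ((y - K) / K') ^ 4 * \<phi> ((y - K) / K') * ((1 + y) / ((y - K) / K')) ^ 4) \<longlongrightarrow> 0) at_top"
    by simp
  then have "\<forall>\<^sub>F y in at_top.
      ((y - K) / K') ^ 4 * \<phi> ((y - K) / K') * ((1 + y) / ((y - K) / K')) ^ 4 < 1 / 4"
    by (rule order_tendstoD) simp
  moreover have "\<forall>\<^sub>F y in at_top. \<theta>0 < (y - K) / K'"
    using affine by (simp add: filterlim_at_top_dense)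
  ultimately show ?thesis
  proof eventually_elim
    case (elim y)
    define \<theta> where "\<theta> = (y - K) / K'"
    have "\<theta> \<noteq> 0" using elim(2) theta0_nonneg unfolding \<theta>_def by linarith
    then have "\<theta> ^ 4 * \<phi> \<theta> * ((1 + y) / \<theta>) ^ 4 = \<phi> \<theta> * (1 + y) ^ 4" by (simp add: power_divide)
    with elim show ?case unfolding \<theta>_def[symmetric] by linarith
  qed
qed

lemma low_block_pr_ge_exp_of_bounds:
  assumes low: "\<delta>' \<le> pr (low_block m s p j j' (- 1))" "0 < \<delta>'"
    and up: "\<forall>\<theta>>\<theta>0. 1 - 2 * \<phi> \<theta>
      \<le> pr (low_block m s p j j' (K + K' * \<theta> - G' * (real_of_int (j' - j))\<^sup>2))"
    and tail: "\<And>y. y0 \<le> y \<Longrightarrow> \<theta>0 < (y - K) / K'"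
      "\<And>y. y0 \<le> y \<Longrightarrow> 4 * \<phi> ((y - K) / K') * (1 + y) ^ 4 \<le> 1"
    and const: "0 < K'" "0 < G'" "1 \<le> y0" "1 \<le> A" "\<bar>ln \<delta>'\<bar> * (1 + y0) ^ 4 \<le> A"
    and y: "y = \<tau> + G' * (real_of_int (j' - j))\<^sup>2" "- 1 \<le> \<tau> \<or> y0 \<le> y"
  shows "exp (- (A / (1 + \<bar>y\<bar>) ^ 4)) \<le> pr (low_block m s p j j' \<tau>)"
proof (cases "y0 \<le> y")
  case True
  define \<theta> where "\<theta> = (y - K) / K'"
  have "exp (- (A / (1 + \<bar>y\<bar>) ^ 4)) \<le> 1 - 2 * \<phi> \<theta>"
    using tail(2) True const(3,4) by (intro exp_quartic_le_one_minus) (auto simp: \<theta>_def)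
  also have "\<dots> \<le> pr (low_block m s p j j' (K + K' * \<theta> - G' * (real_of_int (j' - j))\<^sup>2))"
    using up tail(1)[OF True] unfolding \<theta>_def by blast
  also have "K + K' * \<theta> - G' * (real_of_int (j' - j))\<^sup>2 = \<tau>" using const(1) by (simp add: \<theta>_def y(1))
  finally show ?thesis .
next
  case False
  then have "- 1 \<le> \<tau>" using y(2) by blast
  moreover have "\<tau> \<le> y" using const(2) by (simp add: y(1))
  ultimately have "\<bar>y\<bar> \<le> y0" using False const(3) by simp
  then have "exp (- (A / (1 + \<bar>y\<bar>) ^ 4)) \<le> \<delta>'"
    using low(2) const(5) by (intro exp_quartic_le_const)
  also have "\<dots> \<le> pr (low_block m s p j j' (- 1))" by (rule low(1))
  also have "\<dots> \<le> pr (low_block m s p j j' \<tau>)"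
    using \<open>- 1 \<le> \<tau>\<close> by (intro pr_block_le_mono add_left_mono mult_right_mono) auto
  finally show ?thesis .
qed

lemma low_block_pr_ge_exp:
  "\<exists>m\<ge>1. \<exists>G'>0. \<exists>A>0. \<exists>y0. \<forall>\<^sub>F s in sequentially. \<forall>p j j' \<tau> y.
    y = \<tau> + G' * (real_of_int (j' - j))\<^sup>2 \<longrightarrow> - 1 \<le> \<tau> \<or> y0 \<le> y \<longrightarrow>
    exp (- (A / (1 + \<bar>y\<bar>) ^ 4)) \<le> pr (low_block m s p j j' \<tau>)"
proof -
  obtain m \<delta>' where "1 \<le> m" "0 < \<delta>'" and low: "\<forall>\<^sub>F s in sequentially.
      \<forall>p j j'. \<delta>' \<le> pr (low_block m s p j j' (- 1))"
    using low_block_pr_positive by blast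
  obtain K K' G' where "0 < K'" "0 < G'" and up: "\<forall>\<^sub>F s in sequentially. \<forall>p j j' \<theta>. \<theta>0 < \<theta> \<longrightarrow>
      1 - 2 * \<phi> \<theta> \<le> pr (low_block m s p j j' (K + K' * \<theta> - G' * (real_of_int (j' - j))\<^sup>2))"
    using low_block_upper_tail by blast
  obtain y1 where y1: "\<theta>0 < (y - K) / K'" "4 * \<phi> ((y - K) / K') * (1 + y) ^ 4 \<le> 1" if "y1 \<le> y" for y
    using tail_negligible[OF \<open>0 < K'\<close>, of K] by (auto simp: eventually_at_top_linorder)
  define y0 where "y0 = max 1 y1"
  define A where "A = max 1 (\<bar>ln \<delta>'\<bar> * (1 + y0) ^ 4)"
  have "\<forall>\<^sub>F s in sequentially. \<forall>p j j' \<tau> y. y = \<tau> + G' * (real_of_int (j' - j))\<^sup>2 \<longrightarrow>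
      - 1 \<le> \<tau> \<or> y0 \<le> y \<longrightarrow> exp (- (A / (1 + \<bar>y\<bar>) ^ 4)) \<le> pr (low_block m s p j j' \<tau>)"
    using low up
  proof eventually_elim
    case (elim s)
    show ?case
    proof (intro allI impI)
      fix p j j' :: int and \<tau> y :: real
      assume y: "y = \<tau> + G' * (real_of_int (j' - j))\<^sup>2" "- 1 \<le> \<tau> \<or> y0 \<le> y"
      show "exp (- (A / (1 + \<bar>y\<bar>) ^ 4)) \<le> pr (low_block m s p j j' \<tau>)"
      proof (rule low_block_pr_ge_exp_of_bounds[OF _ \<open>0 < \<delta>'\<close> _ _ _ \<open>0 < K'\<close> \<open>0 < G'\<close> _ _ _ y])
        show "\<delta>' \<le> pr (low_block m s p j j' (- 1))" using elim(1) by blast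
        show "\<forall>\<theta>>\<theta>0. 1 - 2 * \<phi> \<theta>
            \<le> pr (low_block m s p j j' (K + K' * \<theta> - G' * (real_of_int (j' - j))\<^sup>2))"
          using elim(2) by blast
      qed (use y1 in \<open>auto simp: y0_def A_def\<close>)
    qed
  qed
  moreover have "0 < A" by (simp add: A_def)
  ultimately show ?thesis using \<open>1 \<le> m\<close> \<open>0 < G'\<close> by blast
qed

lemma low_block_cost:
  "\<exists>m\<ge>1. \<exists>g>0. \<exists>A>0. \<forall>\<^sub>F s in sequentially. \<forall>k p j j'.
    exp (- (A * block_weight k j j')) \<le> pr (low_block m s p j j' (block_level g k j j'))"
proof -
  obtain m G' A y0 where "1 \<le> m" "0 < G'" "0 < A" and ge_exp: "\<forall>\<^sub>F s in sequentially. \<forall>p j j' \<tau> y.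
    y = \<tau> + G' * (real_of_int (j' - j))\<^sup>2 \<longrightarrow> - 1 \<le> \<tau> \<or> y0 \<le> y \<longrightarrow>
    exp (- (A / (1 + \<bar>y\<bar>) ^ 4)) \<le> pr (low_block m s p j j' \<tau>)"
    using low_block_pr_ge_exp by (elim exE conjE) (rule that)
  define g where "g = min 1 (1 / (2 * (\<bar>y0\<bar> + 1 / G' + 1 / 2)))"
  have pos: "0 < \<bar>y0\<bar> + 1 / G' + 1 / 2" using \<open>0 < G'\<close> by (simp add: add_nonneg_pos)
  then have "0 < g" "g \<le> 1" by (simp_all add: g_def)
  have "g * (y0 + 1 / G' + 1 / 2) \<le> g * (\<bar>y0\<bar> + 1 / G' + 1 / 2)"
    using \<open>0 < g\<close> by (intro mult_left_mono) auto
  also have "\<dots> \<le> 1 / (2 * (\<bar>y0\<bar> + 1 / G' + 1 / 2)) * (\<bar>y0\<bar> + 1 / G' + 1 / 2)"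
    using pos by (intro mult_right_mono) (auto simp: g_def)
  also have "\<dots> = 1 / 2" using pos by simp
  finally have g: "g * (y0 + 1 / G' + 1 / 2) \<le> 1 / 2" .
  obtain B where "0 < B" and B: "\<And>k j j'.
      1 / (1 + \<bar>block_level g k j j' + G' * (real_of_int (j' - j))\<^sup>2\<bar>) ^ 4 \<le> B * block_weight k j j'"
    using inverse_excess_le_block_weight \<open>0 < G'\<close> \<open>0 < g\<close> \<open>g \<le> 1\<close> by metis
  have "\<forall>\<^sub>F s in sequentially. \<forall>k p j j'.
    exp (- (A * B * block_weight k j j')) \<le> pr (low_block m s p j j' (block_level g k j j'))"
    using ge_exp
  proof (rule eventually_mono, intro allI)
    fix s k :: nat and p j j' :: int
    let ?\<tau> = "block_level g k j j'"
    let ?y = "?\<tau> + G' * (real_of_int (j' - j))\<^sup>2"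
    assume ge_exp: "\<forall>p j j' \<tau> y. y = \<tau> + G' * (real_of_int (j' - j))\<^sup>2 \<longrightarrow> - 1 \<le> \<tau> \<or> y0 \<le> y \<longrightarrow>
      exp (- (A / (1 + \<bar>y\<bar>) ^ 4)) \<le> pr (low_block m s p j j' \<tau>)"
    have "A * (1 / (1 + \<bar>?y\<bar>) ^ 4) \<le> A * (B * block_weight k j j')"
      using B \<open>0 < A\<close> by (intro mult_left_mono) auto
    then have "exp (- (A * B * block_weight k j j')) \<le> exp (- (A / (1 + \<bar>?y\<bar>) ^ 4))" by simp
    also have "\<dots> \<le> pr (low_block m s p j j' ?\<tau>)"
      using ge_exp block_level_ge_or_excess_ge[OF \<open>0 < G'\<close> \<open>0 < g\<close> \<open>g \<le> 1\<close> g] by blast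
    finally show "exp (- (A * B * block_weight k j j')) \<le> pr (low_block m s p j j' ?\<tau>)" .
  qed
  then show ?thesis using \<open>1 \<le> m\<close> \<open>0 < g\<close> mult_pos_pos[OF \<open>0 < A\<close> \<open>0 < B\<close>] by blast
qed

end

section \<open>Assembling the blocks\<close>

lemma lpp_le_sum_crossings:
  fixes x x' :: int and k n :: nat
  assumes w: "\<And>v. 0 \<le> w v" and "1 \<le> k" "\<bar>x' - x\<bar> \<le> int (k * n)"
  shows "\<exists>y. y 0 = x \<and> y k = x' \<and> (\<forall>a<k. \<bar>y (Suc a) - y a\<bar> \<le> int n) \<and>
    lpp w (pt p x) (pt (p + int (k * n)) x')
      \<le> (\<Sum>a<k. lpp w (pt (p + int (a * n)) (y a)) (pt (p + int (a * n) + int n) (y (Suc a))))"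
  using assms(2,3)
proof (induction k arbitrary: x' rule: nat_induct_at_least)
  case base
  then show ?case by (intro exI[of _ "\<lambda>a. if a = 0 then x else x'"]) simp
next
  case (Suc k)
  let ?q = "p + int (k * n)"
  have q: "p + int (Suc k * n) = ?q + int n" by simp
  have "pt p x \<le> pt (?q + int n) x'" using Suc.prems by (simp add: pt_le_iff)
  then obtain v where v: "pt p x \<le> v" "v \<le> pt (?q + int n) x'" "level v = 2 * ?q"
    "lpp w (pt p x) (pt (?q + int n) x') \<le> lpp w (pt p x) v + lpp w v (pt (?q + int n) x')"
    by (rule lpp_split_level[where w = w and L = "2 * ?q", OF w]) auto
  define x'' where "x'' = snd v - ?q"
  have v_eq: "v = pt ?q x''" using v(3) unfolding level_eq_iff_pt x''_def .
  have "\<bar>x'' - x\<bar> \<le> int (k * n)" "\<bar>x' - x''\<bar> \<le> int n"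
    using v(1,2) unfolding v_eq pt_le_iff by simp_all
  with Suc.IH obtain y where y: "y 0 = x" "y k = x''" "\<forall>a<k. \<bar>y (Suc a) - y a\<bar> \<le> int n"
    "lpp w (pt p x) (pt ?q x'')
      \<le> (\<Sum>a<k. lpp w (pt (p + int (a * n)) (y a)) (pt (p + int (a * n) + int n) (y (Suc a))))"
    by blast
  have "lpp w (pt p x) (pt (?q + int n) x')
      \<le> (\<Sum>a<k. lpp w (pt (p + int (a * n)) (y a)) (pt (p + int (a * n) + int n) (y (Suc a))))
        + lpp w (pt ?q (y k)) (pt (?q + int n) x')"
    using v(4) y(2,4) by (simp add: v_eq)
  then show ?case
    unfolding q using y(1-3) \<open>\<bar>x' - x''\<bar> \<le> int n\<close>
    by (intro exI[of _ "y(Suc k := x')"]) (simp add: less_Suc_eq)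
qed

lemma abs_le_of_increments:
  fixes y :: "nat \<Rightarrow> 'a :: linordered_idom"
  assumes "y 0 = 0" "\<And>a. a < k \<Longrightarrow> \<bar>y (Suc a) - y a\<bar> \<le> c" "a \<le> k"
  shows "\<bar>y a\<bar> \<le> of_nat a * c"
  using assms(3)
proof (induction a)
  case (Suc a)
  then have "\<bar>y (Suc a) - y a\<bar> \<le> c" "\<bar>y a\<bar> \<le> of_nat a * c" using assms(2) by auto
  then show ?case by (simp add: distrib_right)
qed (simp add: assms(1))

lemma excursion_le_variation:
  fixes J :: "nat \<Rightarrow> 'a :: linordered_idom"
  assumes "J 0 = 0" "J k = 0"
  shows "2 * (\<Sum>a<k. \<bar>J a\<bar>) \<le> of_nat k * (\<Sum>a<k. \<bar>J (Suc a) - J a\<bar>)"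
proof -
  have telescope: "\<bar>J (a + l) - J a\<bar> \<le> (\<Sum>i = a..<a + l. \<bar>J (Suc i) - J i\<bar>)" for a l
    by (induction l) auto
  have "2 * \<bar>J a\<bar> \<le> (\<Sum>i<k. \<bar>J (Suc i) - J i\<bar>)" if "a < k" for a
  proof -
    have "2 * \<bar>J a\<bar> \<le> (\<Sum>i = 0..<a. \<bar>J (Suc i) - J i\<bar>) + (\<Sum>i = a..<k. \<bar>J (Suc i) - J i\<bar>)"
      using telescope[of 0 a] telescope[of a "k - a"] that assms by simp
    also have "\<dots> = (\<Sum>i<k. \<bar>J (Suc i) - J i\<bar>)"
      using that unfolding lessThan_atLeast0 by (intro sum.atLeastLessThan_concat) auto
    finally show ?thesis .
  qed
  then have "(\<Sum>a<k. 2 * \<bar>J a\<bar>) \<le> (\<Sum>b<k. \<Sum>a<k. \<bar>J (Suc a) - J a\<bar>)"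
    by (intro sum_mono) auto
  then show ?thesis by (simp add: sum_distrib_left)
qed

text \<open>The term \<open>- g |j' - j|\<close> pays for the term \<open>2 g |j| / k\<close> along any path that returns to
  column \<open>0\<close>, so the allowance growing with \<open>|j|\<close> is harmless, while it makes the blocks far from
  the diagonal cheap.\<close>

lemma sum_block_level_le:
  assumes "J 0 = 0" "J k = 0" "0 \<le> g"
  shows "(\<Sum>a<k. block_level g k (J a) (J (Suc a))) \<le> - real k / 2"
proof -
  define V where "V = (\<Sum>a<k. \<bar>real_of_int (J (Suc a) - J a)\<bar>)"
  define E where "E = (\<Sum>a<k. \<bar>real_of_int (J a)\<bar>)"
  have "2 * E \<le> real k * V"
    using excursion_le_variation[of "\<lambda>a. real_of_int (J a)" k] assms(1,2) by (simp add: E_def V_def)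
  then have "2 * E / real k \<le> V" by (cases "k = 0") (simp_all add: V_def divide_le_eq mult.commute)
  then have "g * (2 * E / real k) \<le> g * V" using assms(3) by (rule mult_left_mono)
  moreover have "(\<Sum>a<k. block_level g k (J a) (J (Suc a)))
      = - real k / 2 - g * V + 2 * g * (E / real k)"
    by (simp add: block_level_def V_def E_def sum.distrib sum_subtractf sum_distrib_left
        sum_divide_distrib)
  ultimately show ?thesis by (simp add: mult_ac)
qed

lemma abs_div_le:
  fixes x b :: int
  assumes "0 < b"
  shows "\<bar>x div b\<bar> \<le> \<bar>x\<bar>"
proof (cases "0 \<le> x")
  case True
  then show ?thesis using zdiv_mono2[of x 1 b] assms by (simp add: pos_imp_zdiv_nonneg_iff)
next
  case False
  then show ?thesis using zdiv_mono2_neg[of x 1 b] div_neg_pos_less0[of x b] assms by simp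
qed

lemma passage_le_of_low_blocks:
  fixes \<sigma> g :: real
  assumes w: "\<And>v. 0 \<le> w v" and "0 < b" "1 \<le> k" "0 \<le> \<sigma>" "0 \<le> g"
    and blocks: "\<And>a j j'. a < k \<Longrightarrow> j \<in> {- int (k * n)..int (k * n)} \<Longrightarrow>
      j' \<in> {- int (k * n)..int (k * n)} \<Longrightarrow>
      block_le (1 + int (a * n)) n b j j' (\<mu> * real n + block_level g k j j' * \<sigma>) w"
  shows "passage (1 + k * n) 0 w \<le> \<mu> * real (k * n) - real k / 2 * \<sigma>"
proof -
  obtain y where y: "y 0 = 0" "y k = 0" "\<forall>a<k. \<bar>y (Suc a) - y a\<bar> \<le> int n"
    "lpp w (pt 1 0) (pt (1 + int (k * n)) 0)
      \<le> (\<Sum>a<k. lpp w (pt (1 + int (a * n)) (y a)) (pt (1 + int (a * n) + int n) (y (Suc a))))"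
    using lpp_le_sum_crossings[where w = w and x = 0 and x' = 0 and p = 1, OF w \<open>1 \<le> k\<close>, of n]
    by auto
  define J where "J a = y a div b" for a
  have J_bound: "J a \<in> {- int (k * n)..int (k * n)}" if "a \<le> k" for a
  proof -
    have "\<bar>J a\<bar> \<le> \<bar>y a\<bar>" unfolding J_def using \<open>0 < b\<close> by (rule abs_div_le)
    also have "\<dots> \<le> int a * int n" using y(1,3) that by (intro abs_le_of_increments) auto
    also have "\<dots> \<le> int (k * n)" using that by (simp add: mult_right_mono)
    finally show ?thesis by (simp add: abs_le_iff)
  qed
  have crossing: "lpp w (pt (1 + int (a * n)) (y a)) (pt (1 + int (a * n) + int n) (y (Suc a)))
      \<le> \<mu> * real n + block_level g k (J a) (J (Suc a)) * \<sigma>" if "a < k" for a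
  proof -
    have "block_le (1 + int (a * n)) n b (J a) (J (Suc a))
        (\<mu> * real n + block_level g k (J a) (J (Suc a)) * \<sigma>) w"
      using that by (intro blocks J_bound) auto
    then show ?thesis
      using y(3) that \<open>0 < b\<close> by (simp add: block_le_def J_def mem_col_div)
  qed
  have "passage (1 + k * n) 0 w = lpp w (pt 1 0) (pt (1 + int (k * n)) 0)"
    by (simp add: passage_def)
  also have "\<dots> \<le> (\<Sum>a<k. lpp w (pt (1 + int (a * n)) (y a))
      (pt (1 + int (a * n) + int n) (y (Suc a))))"
    by (rule y(4))
  also have "\<dots> \<le> (\<Sum>a<k. \<mu> * real n + block_level g k (J a) (J (Suc a)) * \<sigma>)"
    by (intro sum_mono crossing) simp
  also have "\<dots> = \<mu> * real (k * n) + (\<Sum>a<k. block_level g k (J a) (J (Suc a))) * \<sigma>"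
    by (simp add: sum.distrib sum_distrib_right)
  also have "\<dots> \<le> \<mu> * real (k * n) + (- real k / 2) * \<sigma>"
    using y(1,2) \<open>0 \<le> g\<close> \<open>0 \<le> \<sigma>\<close>
    by (intro add_left_mono mult_right_mono sum_block_level_le) (auto simp: J_def)
  finally show ?thesis by simp
qed

lemma sum_inverse_square_symmetric:
  fixes K :: real
  assumes "1 \<le> K"
  shows "(\<Sum>j\<in>{- int R..int R}. 1 / (1 + \<bar>real_of_int j\<bar> / K)\<^sup>2) \<le> 1 + 2 * K"
proof -
  let ?f = "\<lambda>j::int. 1 / (1 + \<bar>real_of_int j\<bar> / K)\<^sup>2"
  have "sum ?f {- int R..int R} \<le> 1 + 2 * K - 2 * (K * K / (K + real R))"
  proof (induction R)
    case 0
    then show ?case using assms by simp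
  next
    case (Suc R)
    let ?a = "K + real R"
    have "{- int (Suc R)..int (Suc R)}
        = insert (int (Suc R)) (insert (- int (Suc R)) {- int R..int R})"
      by auto
    then have "sum ?f {- int (Suc R)..int (Suc R)} = 2 * ?f (int (Suc R)) + sum ?f {- int R..int R}"
      by (simp add: add.commute)
    also have "?f (int (Suc R)) = K * K / ((?a + 1) * (?a + 1))"
      using assms by (simp add: field_simps power2_eq_square)
    also have "\<dots> \<le> K * K / (?a * (?a + 1))"
      using assms by (intro divide_left_mono mult_right_mono mult_pos_pos) auto
    also have "\<dots> = K * K / ?a - K * K / (?a + 1)"
      using assms by (simp add: field_simps)
    finally show ?case using Suc.IH by (simp add: algebra_simps)
  qed
  also have "\<dots> \<le> 1 + 2 * K" using assms by simp
  finally show ?thesis .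
qed

lemma sum_block_weight_le:
  assumes "1 \<le> k"
  shows "(\<Sum>j\<in>{- int R..int R}. \<Sum>j'\<in>{- int R..int R}. block_weight k j j') \<le> 9 * real k"
proof -
  let ?I = "{- int R..int R}"
  let ?f = "\<lambda>j::int. 1 / (1 + \<bar>real_of_int j\<bar> / real k)\<^sup>2"
  let ?g = "\<lambda>d::int. 1 / (1 + \<bar>real_of_int d\<bar> / 1)\<^sup>2"
  have inner: "(\<Sum>j'\<in>?I. ?g (j' - j)) \<le> 3" if "j \<in> ?I" for j
  proof -
    have "(\<Sum>j'\<in>?I. ?g (j' - j)) = sum ?g ((\<lambda>j'. j' - j) ` ?I)"
      by (subst sum.reindex) (auto simp: inj_on_def)
    also have "\<dots> \<le> sum ?g {- int (2 * R)..int (2 * R)}"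
      using that by (intro sum_mono2) auto
    also have "\<dots> \<le> 1 + 2 * 1" by (rule sum_inverse_square_symmetric) simp
    finally show ?thesis by simp
  qed
  have "(\<Sum>j\<in>?I. \<Sum>j'\<in>?I. block_weight k j j') = (\<Sum>j\<in>?I. ?f j * (\<Sum>j'\<in>?I. ?g (j' - j)))"
    by (simp add: block_weight_def sum_distrib_left mult.commute)
  also have "\<dots> \<le> (\<Sum>j\<in>?I. ?f j * 3)"
    by (intro sum_mono mult_left_mono inner) auto
  also have "\<dots> = 3 * (\<Sum>j\<in>?I. ?f j)" by (simp add: sum_distrib_left mult.commute)
  also have "\<dots> \<le> 3 * (1 + 2 * real k)"
    using assms by (intro mult_left_mono sum_inverse_square_symmetric) auto
  also have "\<dots> \<le> 9 * real k" using assms by simp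
  finally show ?thesis .
qed

context lpp_fluctuations
begin

lemma low_passage_pr_ge:
  fixes m s k :: nat
  defines "n \<equiv> m * s"
  assumes "1 \<le> s" "1 \<le> k" "0 < A" "0 < g"
    and cost: "\<And>p j j'. exp (- (A * block_weight k j j'))
      \<le> pr (low_block m s p j j' (block_level g k j j'))"
  shows "exp (- (9 * A * (real k)\<^sup>2))
    \<le> pr (\<lambda>w. passage (1 + k * n) 0 w \<le> \<mu> * real (k * n) - real k / 2 * root 3 (real s))"
proof -
  define I where "I = {- int (k * n)..int (k * n)}"
  define T where "T = {..<k} \<times> I \<times> I"
  define weight where "weight e = block_weight k (fst (snd e)) (snd (snd e))"
    for e :: "nat \<times> int \<times> int"
  define low where "low e = low_block m s (1 + int (fst e * n)) (fst (snd e)) (snd (snd e))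
    (block_level g k (fst (snd e)) (snd (snd e)))" for e :: "nat \<times> int \<times> int"
  have "finite T" by (simp add: T_def I_def)
  have "(\<Sum>e\<in>T. A * weight e) = real k * (A * (\<Sum>j\<in>I. \<Sum>j'\<in>I. block_weight k j j'))"
    by (simp add: T_def weight_def sum.cartesian_product' sum_distrib_left)
  also have "\<dots> \<le> real k * (A * (9 * real k))"
    unfolding I_def using \<open>0 < A\<close> \<open>1 \<le> k\<close> by (intro mult_left_mono sum_block_weight_le) auto
  finally have "exp (- (9 * A * (real k)\<^sup>2)) \<le> exp (\<Sum>e\<in>T. - (A * weight e))"
    by (simp add: sum_negf power2_eq_square mult_ac)
  also have "\<dots> = (\<Prod>e\<in>T. exp (- (A * weight e)))" using \<open>finite T\<close> by (rule exp_sum)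
  also have "\<dots> \<le> (\<Prod>e\<in>T. pr (low e))"
    unfolding weight_def low_def by (intro prod_mono conjI cost) simp
  also have "\<dots> \<le> pr (\<lambda>w. \<forall>e\<in>T. low e w)"
    unfolding low_def by (intro harris_Ball \<open>finite T\<close> decreasing_cylinder_block_le)
  also have "\<dots> \<le> pr (\<lambda>w. passage (1 + k * n) 0 w \<le> \<mu> * real (k * n) - real k / 2 * root 3 (real s))"
  proof (rule pr_mono_nonneg)
    fix w :: "int \<times> int \<Rightarrow> real" assume w: "\<And>v. 0 \<le> w v" and "\<forall>e\<in>T. low e w"
    then have "low_block m s (1 + int (a * n)) j j' (block_level g k j j') w"
      if "a < k" "j \<in> I" "j' \<in> I" for a j j'
      using that by (force simp: T_def low_def)
    then show "passage (1 + k * n) 0 w \<le> \<mu> * real (k * n) - real k / 2 * root 3 (real s)"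
      using \<open>1 \<le> k\<close> \<open>0 < g\<close> block_width_bounds(1)[OF \<open>1 \<le> s\<close>]
      by (intro passage_le_of_low_blocks[where b = "block_width s" and g = g] w)
        (auto simp: I_def n_def)
  qed measurable
  finally show ?thesis .
qed

lemma low_passage_cost:
  "\<exists>m\<ge>1. \<exists>A>0. \<forall>\<^sub>F s in sequentially. \<forall>k\<ge>1. exp (- (A * (real k)\<^sup>2))
    \<le> pr (\<lambda>w. passage (1 + k * (m * s)) 0 w
        \<le> \<mu> * real (k * (m * s)) - real k / 2 * root 3 (real s))"
proof -
  obtain m g A where "1 \<le> m" "0 < g" "0 < A" and cost: "\<forall>\<^sub>F s in sequentially. \<forall>k p j j'.
    exp (- (A * block_weight k j j')) \<le> pr (low_block m s p j j' (block_level g k j j'))"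
    using low_block_cost by blast
  from cost eventually_ge_at_top[of 1]
  have "\<forall>\<^sub>F s in sequentially. \<forall>k\<ge>1. exp (- (9 * A * (real k)\<^sup>2))
    \<le> pr (\<lambda>w. passage (1 + k * (m * s)) 0 w
        \<le> \<mu> * real (k * (m * s)) - real k / 2 * root 3 (real s))"
  proof eventually_elim
    case (elim s)
    then show ?case using low_passage_pr_ge[OF elim(2) _ \<open>0 < A\<close> \<open>0 < g\<close>] by blast
  qed
  then show ?thesis using \<open>1 \<le> m\<close> \<open>0 < A\<close> by (intro exI[of _ m] conjI exI[of _ "9 * A"]) auto
qed

end

section \<open>The lower tail\<close>

lemma slab_level_le:
  fixes \<mu> \<sigma> \<theta> u r n k m :: real
  assumes "r \<le> n" "n \<le> r + k * m" "0 \<le> k" "4 * \<bar>\<mu>\<bar> * m \<le> \<sigma>" "4 * \<theta> * u \<le> k * \<sigma>"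
  shows "\<mu> * n - k / 2 * \<sigma> \<le> \<mu> * r - \<theta> * u"
proof -
  have "\<mu> * (n - r) \<le> \<bar>\<mu>\<bar> * (n - r)" using assms(1) by (intro mult_right_mono) auto
  also have "\<dots> \<le> \<bar>\<mu>\<bar> * (k * m)" using assms(2) by (intro mult_left_mono) auto
  also have "\<dots> \<le> k / 4 * \<sigma>"
    using mult_left_mono[OF assms(4), of "k / 4"] assms(3) by (simp add: mult_ac)
  finally show ?thesis using assms(5) by (simp add: right_diff_distrib)
qed

lemma sqrt_cube_le:
  fixes \<theta> \<eta> x :: real
  assumes "0 \<le> \<theta>" "\<theta> \<le> \<eta> * x\<^sup>2" "0 \<le> \<eta>" "\<eta> \<le> 1" "0 \<le> x"
  shows "sqrt (\<theta> ^ 3) \<le> \<eta> * x ^ 3"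
proof (rule real_le_lsqrt)
  have "\<theta> ^ 3 \<le> (\<eta> * x\<^sup>2) ^ 3" using assms(1,2) by (intro power_mono)
  also have "\<dots> = \<eta> ^ 3 * (x ^ 3)\<^sup>2" by algebra
  also have "\<dots> \<le> \<eta>\<^sup>2 * (x ^ 3)\<^sup>2"
    using assms(3,4) by (intro mult_right_mono power_decreasing) auto
  finally show "\<theta> ^ 3 \<le> (\<eta> * x ^ 3)\<^sup>2" by (simp add: power_mult_distrib)
qed (use assms in simp)

lemma mult_root3_le_mult_root3:
  fixes x y r s :: real
  assumes "x ^ 3 * r \<le> y ^ 3 * s"
  shows "x * root 3 r \<le> y * root 3 s"
proof -
  have "root 3 (x ^ 3 * r) \<le> root 3 (y ^ 3 * s)" using assms by simp
  then show ?thesis by (simp add: real_root_mult odd_real_root_power_cancel)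
qed

lemma mult_root3_ge_of_scales:
  fixes \<theta> m k s r :: real
  assumes "1 \<le> m" "0 \<le> \<theta>" "0 \<le> r" and k: "64 * m\<^sup>2 * \<theta> ^ 3 \<le> k\<^sup>2" and s: "r \<le> k * m * s"
  shows "4 * \<theta> * root 3 r \<le> k * root 3 s"
proof (rule mult_root3_le_mult_root3)
  have "64 * m\<^sup>2 * \<theta> ^ 3 * r \<le> k\<^sup>2 * (k * m * s)" using k s assms(3) by (intro mult_mono) auto
  then have "m * (64 * m * \<theta> ^ 3 * r) \<le> m * (k ^ 3 * s)"
    by (simp add: power2_eq_square power3_eq_cube mult_ac)
  then have "64 * m * \<theta> ^ 3 * r \<le> k ^ 3 * s" using assms(1) by simp
  moreover have "64 * \<theta> ^ 3 * r \<le> 64 * m * \<theta> ^ 3 * r"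
    using assms(1-3) by (intro mult_right_mono) auto
  ultimately show "(4 * \<theta>) ^ 3 * r \<le> k ^ 3 * s" by (simp add: power_mult_distrib)
qed

lemma slab_scales_exist:
  fixes m s1 r :: nat and \<theta> :: real
  defines "\<eta> \<equiv> 1 / (16 * (real m)\<^sup>2 * real s1)"
  assumes "1 \<le> m" "1 \<le> s1" "1 \<le> \<theta>" and \<theta>_less: "\<theta> < \<eta> * (root 3 (real r))\<^sup>2"
  obtains k s where "1 \<le> k" "s1 \<le> s"
    "r \<le> k * (m * s)" "real (k * (m * s)) \<le> real r + real k * real m"
    "4 * \<theta> * root 3 (real r) \<le> real k * root 3 (real s)" "(real k)\<^sup>2 \<le> (16 * real m)\<^sup>2 * \<theta> ^ 3"
proof
  define T where "T = sqrt (\<theta> ^ 3)"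
  have T2: "T\<^sup>2 = \<theta> ^ 3" and "1 \<le> T" using \<open>1 \<le> \<theta>\<close> by (simp_all add: T_def)
  define k where "k = nat \<lceil>8 * real m * T\<rceil>"
  define s where "s = nat \<lceil>real r / (real k * real m)\<rceil>"
  have "1 \<le> real m * T" using \<open>1 \<le> m\<close> \<open>1 \<le> T\<close> mult_mono[of 1 "real m" 1 T] by simp
  then have k_ge: "8 * real m * T \<le> real k" and k_le: "real k \<le> 16 * real m * T"
    unfolding k_def by linarith+
  then show "1 \<le> k" using \<open>1 \<le> real m * T\<close> by linarith
  then have km_pos: "0 < real k * real m" using \<open>1 \<le> m\<close> by simp
  have s_ge: "real r / (real k * real m) \<le> real s" unfolding s_def by linarith
  then have ks_ge: "real r \<le> real k * real m * real s"
    using km_pos by (simp add: divide_le_eq mult_ac)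
  then have "real r \<le> real (k * (m * s))" by (simp add: mult_ac)
  then show "r \<le> k * (m * s)" by linarith
  have "real (k * (m * s)) = real k * real m * real s" by simp
  also have "\<dots> \<le> real k * real m * (real r / (real k * real m) + 1)"
    using km_pos unfolding s_def by (intro mult_left_mono) (simp_all add: ceiling_correct)
  also have "\<dots> = real r + real k * real m"
    using nonzero_mult_div_cancel_left[of "real k * real m" "real r"] km_pos
    by (simp only: distrib_left times_divide_eq_right mult_1_right)
  finally show "real (k * (m * s)) \<le> real r + real k * real m" .
  have "1 \<le> (real m)\<^sup>2 * real s1"
    using \<open>1 \<le> m\<close> \<open>1 \<le> s1\<close> mult_mono[of 1 "(real m)\<^sup>2" 1 "real s1"] by simp
  then have "0 \<le> \<eta>" "\<eta> \<le> 1"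
    using frac_le[of 1 1 1 "16 * (real m)\<^sup>2 * real s1"] by (simp_all add: \<eta>_def)
  then have "T \<le> \<eta> * root 3 (real r) ^ 3"
    unfolding T_def using \<open>1 \<le> \<theta>\<close> \<theta>_less by (intro sqrt_cube_le) auto
  then have "16 * (real m)\<^sup>2 * real s1 * T \<le> real r"
    using \<open>1 \<le> m\<close> \<open>1 \<le> s1\<close> by (simp add: \<eta>_def field_simps)
  moreover have "real k * (real m * real s1) \<le> 16 * real m * T * (real m * real s1)"
    using k_le by (intro mult_right_mono) auto
  ultimately have "real s1 \<le> real r / (real k * real m)"
    using km_pos by (simp add: le_divide_eq power2_eq_square mult_ac)
  then show "s1 \<le> s" using s_ge by linarith
  have "64 * (real m)\<^sup>2 * \<theta> ^ 3 \<le> (real k)\<^sup>2"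
    using power_mono[OF k_ge, of 2] \<open>1 \<le> T\<close> by (simp add: power_mult_distrib T2)
  then show "4 * \<theta> * root 3 (real r) \<le> real k * root 3 (real s)"
    using \<open>1 \<le> m\<close> \<open>1 \<le> \<theta>\<close> ks_ge by (intro mult_root3_ge_of_scales[where m = "real m"]) auto
  show "(real k)\<^sup>2 \<le> (16 * real m)\<^sup>2 * \<theta> ^ 3"
    using power_mono[OF k_le, of 2] by (simp add: power_mult_distrib T2)
qed

context lpp_fluctuations
begin

lemma lower_tail_ge:
  "\<exists>c>0. \<exists>\<eta>>0. \<forall>r \<theta>. 1 \<le> \<theta> \<longrightarrow> \<theta> < \<eta> * (root 3 (real r))\<^sup>2 \<longrightarrow>
    exp (- c * \<theta> ^ 3) \<le> pr (\<lambda>w. passage r 0 w \<le> \<mu> * real r - \<theta> * root 3 (real r))"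
proof -
  obtain m A where "1 \<le> m" "0 < A" and cost: "\<forall>\<^sub>F s in sequentially. \<forall>k\<ge>1.
    exp (- (A * (real k)\<^sup>2)) \<le> pr (\<lambda>w. passage (1 + k * (m * s)) 0 w
        \<le> \<mu> * real (k * (m * s)) - real k / 2 * root 3 (real s))"
    using low_passage_cost by blast
  have "filterlim (\<lambda>s. root 3 (real s)) at_top sequentially" by real_asymp
  then have "\<forall>\<^sub>F s in sequentially. 4 * \<bar>\<mu>\<bar> * real m \<le> root 3 (real s)"
    by (simp add: filterlim_at_top)
  from eventually_conj[OF cost this] obtain s0 where
    s0: "\<And>s. s0 \<le> s \<Longrightarrow> (\<forall>k\<ge>1. exp (- (A * (real k)\<^sup>2)) \<le> pr (\<lambda>w. passage (1 + k * (m * s)) 0 w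
        \<le> \<mu> * real (k * (m * s)) - real k / 2 * root 3 (real s)))
      \<and> 4 * \<bar>\<mu>\<bar> * real m \<le> root 3 (real s)"
    by (auto simp: eventually_sequentially)
  define s1 where "s1 = max 1 s0"
  define \<eta> where "\<eta> = 1 / (16 * (real m)\<^sup>2 * real s1)"
  define c where "c = A * (16 * real m)\<^sup>2"
  have "exp (- c * \<theta> ^ 3) \<le> pr (\<lambda>w. passage r 0 w \<le> \<mu> * real r - \<theta> * root 3 (real r))"
    if "1 \<le> \<theta>" and \<theta>_less: "\<theta> < \<eta> * (root 3 (real r))\<^sup>2" for r \<theta>
  proof -
    obtain k s where "1 \<le> k" "s1 \<le> s"
      and n: "r \<le> k * (m * s)" "real (k * (m * s)) \<le> real r + real k * real m"
      and gain: "4 * \<theta> * root 3 (real r) \<le> real k * root 3 (real s)"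
      and k_le: "(real k)\<^sup>2 \<le> (16 * real m)\<^sup>2 * \<theta> ^ 3"
      using slab_scales_exist[of m s1 \<theta> r] \<open>1 \<le> m\<close> \<open>1 \<le> \<theta>\<close> \<theta>_less by (auto simp: \<eta>_def s1_def)
    have "s0 \<le> s" using \<open>s1 \<le> s\<close> by (simp add: s1_def)
    have "1 \<le> r" using \<open>1 \<le> \<theta>\<close> \<theta>_less by (cases r) auto
    have level: "\<mu> * real (k * (m * s)) - real k / 2 * root 3 (real s)
        \<le> \<mu> * real r - \<theta> * root 3 (real r)"
      using n gain s0[OF \<open>s0 \<le> s\<close>]
      by (intro slab_level_le[where m = "real m"]) (auto simp flip: of_nat_mult)
    have "A * (real k)\<^sup>2 \<le> c * \<theta> ^ 3"
      using mult_left_mono[OF k_le, of A] \<open>0 < A\<close> by (simp add: c_def mult_ac)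
    then have "exp (- c * \<theta> ^ 3) \<le> exp (- (A * (real k)\<^sup>2))" by simp
    also have "\<dots> \<le> pr (\<lambda>w. passage (1 + k * (m * s)) 0 w
        \<le> \<mu> * real (k * (m * s)) - real k / 2 * root 3 (real s))"
      using s0[OF \<open>s0 \<le> s\<close>] \<open>1 \<le> k\<close> by blast
    also have "\<dots> \<le> pr (\<lambda>w. passage r 0 w \<le> \<mu> * real r - \<theta> * root 3 (real r))"
      using \<open>1 \<le> r\<close> n(1) level by (intro pr_passage_le_mono) auto
    finally show ?thesis .
  qed
  moreover have "0 < c" "0 < \<eta>" using \<open>0 < A\<close> \<open>1 \<le> m\<close> by (auto simp: c_def \<eta>_def s1_def)
  ultimately show ?thesis by blast
qed

theorem recentred_lower_tail_ge:
  fixes mean :: "nat \<Rightarrow> real"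
  assumes mean: "\<forall>\<^sub>F r in sequentially. \<mu> * real r - g * root 3 (real r) \<le> mean r"
  shows "\<exists>c>0. \<exists>\<eta>>0. \<exists>\<theta>1. \<forall>\<^sub>F r in sequentially. \<forall>\<theta>. \<theta>1 < \<theta> \<and> \<theta> < \<eta> * (root 3 (real r))\<^sup>2 \<longrightarrow>
    exp (- c * \<theta> ^ 3) \<le> pr (\<lambda>w. passage r 0 w - mean r \<le> - \<theta> * root 3 (real r))"
proof -
  obtain c \<eta> where "0 < c" "0 < \<eta>" and tail: "\<And>r \<theta>. 1 \<le> \<theta> \<Longrightarrow> \<theta> < \<eta> * (root 3 (real r))\<^sup>2 \<Longrightarrow>
    exp (- c * \<theta> ^ 3) \<le> pr (\<lambda>w. passage r 0 w \<le> \<mu> * real r - \<theta> * root 3 (real r))"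
    using lower_tail_ge by blast
  from mean have "\<forall>\<^sub>F r in sequentially.
    \<forall>\<theta>. max 1 g < \<theta> \<and> \<theta> < \<eta> / 2 * (root 3 (real r))\<^sup>2 \<longrightarrow>
    exp (- (8 * c) * \<theta> ^ 3) \<le> pr (\<lambda>w. passage r 0 w - mean r \<le> - \<theta> * root 3 (real r))"
  proof (rule eventually_mono, intro allI impI)
    fix r :: nat and \<theta> :: real
    assume mean: "\<mu> * real r - g * root 3 (real r) \<le> mean r"
      and \<theta>: "max 1 g < \<theta> \<and> \<theta> < \<eta> / 2 * (root 3 (real r))\<^sup>2"
    have "exp (- (8 * c) * \<theta> ^ 3) \<le> pr (\<lambda>w. passage r 0 w \<le> \<mu> * real r - 2 * \<theta> * root 3 (real r))"
      using tail[of "2 * \<theta>" r] \<theta> by (simp add: power_mult_distrib mult_ac)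
    also have "\<dots> \<le> pr (\<lambda>w. passage r 0 w - mean r \<le> - \<theta> * root 3 (real r))"
    proof (rule pr_mono)
      have "g * root 3 (real r) \<le> \<theta> * root 3 (real r)" using \<theta> by (intro mult_right_mono) auto
      then show "passage r 0 w - mean r \<le> - \<theta> * root 3 (real r)"
        if "passage r 0 w \<le> \<mu> * real r - 2 * \<theta> * root 3 (real r)" for w
        using that mean by simp
    qed measurable
    finally show "exp (- (8 * c) * \<theta> ^ 3)
        \<le> pr (\<lambda>w. passage r 0 w - mean r \<le> - \<theta> * root 3 (real r))" .
  qed
  moreover have "0 < 8 * c" "0 < \<eta> / 2" using \<open>0 < c\<close> \<open>0 < \<eta>\<close> by simp_all
  ultimately show ?thesis by blast
qed

end

section \<open>The paper's assumptions\<close>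

lemma eventually_sequentially_real:
  "(\<forall>\<^sub>F n in sequentially. P n) \<longleftrightarrow> (\<exists>x::real. \<forall>n. x < real n \<longrightarrow> P n)"
proof
  assume "\<forall>\<^sub>F n in sequentially. P n"
  then obtain N where "\<forall>n\<ge>N. P n" by (auto simp: eventually_sequentially)
  then show "\<exists>x::real. \<forall>n. x < real n \<longrightarrow> P n" by (intro exI[of _ "real N"]) auto
next
  assume "\<exists>x::real. \<forall>n. x < real n \<longrightarrow> P n"
  then obtain x :: real where x: "\<forall>n. x < real n \<longrightarrow> P n" ..
  have "\<forall>\<^sub>F n in sequentially. x < real n"
    using filterlim_real_sequentially by (simp add: filterlim_at_top_dense)
  then show "\<forall>\<^sub>F n in sequentially. P n" by (rule eventually_mono) (use x in blast)
qed

lemma powr_third: "real n powr (1/3) = root 3 (real n)"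
  using root_powr_inverse[of 3 "real n"] by simp

lemma powr_two_thirds: "real n powr (2/3) = (root 3 (real n))\<^sup>2"
  by (cases "n = 0") (simp_all add: powr_power flip: powr_third)

definition parabolic_mean ::
  "real \<Rightarrow> real \<Rightarrow> real \<Rightarrow> real \<Rightarrow> real \<Rightarrow> real \<Rightarrow> (nat \<Rightarrow> int \<Rightarrow> real) \<Rightarrow> bool" where
  "parabolic_mean \<mu> \<rho> G H g1 g2 mean \<longleftrightarrow>
    (\<forall>\<^sub>F n in sequentially. \<forall>z. \<bar>real_of_int z\<bar> \<le> \<rho> * real n \<longrightarrow>
      \<mu> * real n - G * real_of_int z ^ 2 / real n - H * real_of_int z ^ 4 / real n ^ 3
        - g1 * root 3 (real n) \<le> mean n z \<and>
      mean n z \<le> \<mu> * real n - G * real_of_int z ^ 2 / real n - g2 * root 3 (real n))"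

lemma parabolic_mean_le:
  assumes "parabolic_mean \<mu> \<rho> G H g1 g2 mean" "0 \<le> g2"
  shows "\<forall>\<^sub>F n in sequentially. \<forall>z. \<bar>real_of_int z\<bar> \<le> \<rho> * real n \<longrightarrow>
    mean n z \<le> \<mu> * real n - G * (real_of_int z)\<^sup>2 / real n"
  using assms(1)[unfolded parabolic_mean_def]
proof eventually_elim
  case (elim n)
  moreover have "0 \<le> g2 * root 3 (real n)" using assms(2) by simp
  ultimately show ?case by fastforce
qed

lemma parabola_corrections_le:
  fixes z :: real
  assumes "\<bar>z\<bar> \<le> (root 3 (real n))\<^sup>2"
  shows "z ^ 2 / real n \<le> root 3 (real n)" "z ^ 4 / real n ^ 3 \<le> root 3 (real n)"
proof -
  define \<sigma> where "\<sigma> = root 3 (real n)"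
  have n: "real n = \<sigma> ^ 3" and "\<bar>z\<bar> \<le> \<sigma>\<^sup>2" using assms by (simp_all add: \<sigma>_def)
  then have squares: "z\<^sup>2 \<le> \<sigma> * \<sigma> ^ 3" "z ^ 4 \<le> \<sigma> ^ 8"
    using power_mono[of "\<bar>z\<bar>" "\<sigma>\<^sup>2" 2] power_mono[of "\<bar>z\<bar>" "\<sigma>\<^sup>2" 4]
    by (simp_all flip: power_mult power_Suc)
  have "0 < \<sigma> ^ 3 \<and> \<sigma> ^ 8 \<le> \<sigma> * (\<sigma> ^ 3) ^ 3" if "n \<noteq> 0"
  proof -
    have "1 \<le> \<sigma>" using that by (simp add: \<sigma>_def)
    then show ?thesis using power_increasing[of 8 10 \<sigma>] by (simp flip: power_mult power_Suc)
  qed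
  with squares show "z ^ 2 / real n \<le> root 3 (real n)" "z ^ 4 / real n ^ 3 \<le> root 3 (real n)"
    unfolding n \<sigma>_def[symmetric] by (cases "n = 0"; auto simp: divide_le_eq \<sigma>_def)+
qed

lemma parabolic_mean_ge_near_diagonal:
  assumes mean: "parabolic_mean \<mu> \<rho> G H g1 g2 mean" and pos: "0 < \<rho>" "0 \<le> G" "0 \<le> H"
  shows "\<forall>\<^sub>F n in sequentially. \<forall>z. \<bar>real_of_int z\<bar> \<le> (root 3 (real n))\<^sup>2 \<longrightarrow>
    \<mu> * real n - (G + H + g1) * root 3 (real n) \<le> mean n z"
proof -
  have "\<forall>\<^sub>F n in sequentially. (root 3 (real n))\<^sup>2 \<le> \<rho> * real n" using pos(1) by real_asymp
  with mean[unfolded parabolic_mean_def] show ?thesis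
  proof eventually_elim
    case (elim n)
    show ?case
    proof (intro allI impI)
      fix z :: int assume z: "\<bar>real_of_int z\<bar> \<le> (root 3 (real n))\<^sup>2"
      note mult_left_mono[OF parabola_corrections_le(1)[OF z] pos(2)]
        mult_left_mono[OF parabola_corrections_le(2)[OF z] pos(3)]
      then have "\<mu> * real n - (G + H + g1) * root 3 (real n)
          \<le> \<mu> * real n - G * real_of_int z ^ 2 / real n - H * real_of_int z ^ 4 / real n ^ 3
            - g1 * root 3 (real n)"
        by (simp add: algebra_simps)
      also have "\<dots> \<le> mean n z" using elim z by (meson order.trans)
      finally show "\<mu> * real n - (G + H + g1) * root 3 (real n) \<le> mean n z" .
    qed
  qed
qed

context iid_field
begin

lemma lower_tight_of_lower_tail:
  fixes mean :: "nat \<Rightarrow> int \<Rightarrow> real" and \<psi> :: "real \<Rightarrow> real"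
  assumes "0 \<le> B" and mean: "\<forall>\<^sub>F n in sequentially.
      \<forall>z. \<bar>real_of_int z\<bar> \<le> (root 3 (real n))\<^sup>2 \<longrightarrow> \<mu> * real n - B * root 3 (real n) \<le> mean n z"
    and tail: "lower_tail_bound mean \<kappa> \<theta>0 \<psi>" "0 < \<kappa>" "(\<psi> \<longlongrightarrow> 0) at_top"
    and "0 < \<epsilon>"
  shows "\<exists>D>0. \<forall>\<^sub>F n in sequentially. \<forall>z. \<bar>real_of_int z\<bar> \<le> (root 3 (real n))\<^sup>2 \<longrightarrow>
    1 - \<epsilon> \<le> pr (\<lambda>w. \<mu> * real n - D * root 3 (real n) \<le> passage n z w)"
proof -
  have "\<forall>\<^sub>F \<theta> in at_top. \<psi> \<theta> < \<epsilon> \<and> max 0 \<theta>0 < \<theta>"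
    using order_tendstoD(2)[OF tail(3) \<open>0 < \<epsilon>\<close>] eventually_gt_at_top by (rule eventually_conj)
  then obtain \<theta> where \<theta>: "\<psi> \<theta> < \<epsilon>" "0 < \<theta>" "\<theta>0 < \<theta>"
    by (auto dest!: eventually_happens'[OF trivial_limit_at_top_linorder])
  have "\<forall>\<^sub>F n in sequentially. (root 3 (real n))\<^sup>2 \<le> \<kappa> * real n" using tail(2) by real_asymp
  with mean tail(1)[unfolded lower_tail_bound_def]
  have "\<forall>\<^sub>F n in sequentially. \<forall>z. \<bar>real_of_int z\<bar> \<le> (root 3 (real n))\<^sup>2 \<longrightarrow>
    1 - \<epsilon> \<le> pr (\<lambda>w. \<mu> * real n - (B + \<theta>) * root 3 (real n) \<le> passage n z w)"
  proof eventually_elim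
    case (elim n)
    show ?case
    proof (intro allI impI)
      fix z :: int assume z: "\<bar>real_of_int z\<bar> \<le> (root 3 (real n))\<^sup>2"
      let ?low = "\<lambda>w. passage n z w - mean n z < - \<theta> * root 3 (real n)"
      have "\<mu> * real n - B * root 3 (real n) \<le> mean n z" using elim(1) z by blast
      then have "pr (\<lambda>w. \<not> ?low w)
          \<le> pr (\<lambda>w. \<mu> * real n - (B + \<theta>) * root 3 (real n) \<le> passage n z w)"
        by (intro pr_mono) (auto simp: algebra_simps)
      moreover have "pr (\<lambda>w. \<not> ?low w) = 1 - pr ?low" by (rule pr_not) measurable
      moreover have "pr ?low \<le> \<psi> \<theta>" using elim(2,3) z \<theta>(3) by (meson order.trans)
      ultimately show "1 - \<epsilon> \<le> pr (\<lambda>w. \<mu> * real n - (B + \<theta>) * root 3 (real n) \<le> passage n z w)"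
        using \<theta>(1) by linarith
    qed
  qed
  moreover have "0 < B + \<theta>" using \<open>0 \<le> B\<close> \<theta>(2) by simp
  ultimately show ?thesis by blast
qed

lemma upper_tail_bound_recentre:
  assumes center: "\<forall>\<^sub>F n in sequentially.
      \<forall>z. \<bar>real_of_int z\<bar> \<le> \<rho> * real n \<longrightarrow> center n z \<le> center' n z"
    and "upper_tail_bound center \<kappa> \<theta>0 \<phi>"
  shows "upper_tail_bound center' (min \<rho> \<kappa>) \<theta>0 \<phi>"
  using center assms(2)[unfolded upper_tail_bound_def] unfolding upper_tail_bound_def
proof eventually_elim
  case (elim n)
  show ?case
  proof (intro allI impI)
    fix \<theta> :: real and z :: int
    assume \<theta>z: "\<theta>0 < \<theta> \<and> \<bar>real_of_int z\<bar> \<le> min \<rho> \<kappa> * real n"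
    then have z: "\<bar>real_of_int z\<bar> \<le> \<rho> * real n" "\<bar>real_of_int z\<bar> \<le> \<kappa> * real n"
      by (auto simp: min_mult_distrib_right split: if_splits)
    have "pr (\<lambda>w. passage n z w - center' n z > \<theta> * root 3 (real n))
        \<le> pr (\<lambda>w. passage n z w - center n z > \<theta> * root 3 (real n))"
      using elim(1) z(1) by (intro pr_mono) (auto intro: less_le_trans)
    also have "\<dots> \<le> \<phi> \<theta>" using elim(2) z(2) \<theta>z by blast
    finally show "pr (\<lambda>w. passage n z w - center' n z > \<theta> * root 3 (real n)) \<le> \<phi> \<theta>" .
  qed
qed

theorem lower_tail_lower_bound:
  fixes mean :: "nat \<Rightarrow> int \<Rightarrow> real"
  assumes mean: "parabolic_mean \<mu> \<rho> G H g1 g2 mean"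
    and upper: "upper_tail_bound mean \<kappa> \<theta>0 \<phi>" "((\<lambda>\<theta>. \<theta> ^ 4 * \<phi> \<theta>) \<longlongrightarrow> 0) at_top"
    and lower: "lower_tail_bound mean \<kappa>' \<theta>0' \<psi>" "(\<psi> \<longlongrightarrow> 0) at_top"
    and low_passage: "\<forall>\<^sub>F n in sequentially.
      \<delta> \<le> pr (\<lambda>w. passage n 0 w - \<mu> * real n < - C * root 3 (real n))"
    and pos: "0 < \<rho>" "0 < G" "0 \<le> H" "0 \<le> g1" "0 \<le> g2"
      "0 < \<kappa>" "0 \<le> \<theta>0" "0 < \<kappa>'" "0 < \<delta>" "0 < C"
  shows "\<exists>c>0. \<exists>\<eta>>0. \<exists>\<theta>1. \<forall>\<^sub>F n in sequentially. \<forall>\<theta>.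
    \<theta>1 < \<theta> \<and> \<theta> < \<eta> * (root 3 (real n))\<^sup>2 \<longrightarrow>
    exp (- c * \<theta> ^ 3) \<le> pr (\<lambda>w. passage n 0 w - mean n 0 \<le> - \<theta> * root 3 (real n))"
proof -
  note mean_ge = parabolic_mean_ge_near_diagonal[OF mean pos(1) less_imp_le[OF pos(2)] pos(3)]
  have "lpp_fluctuations \<nu> \<mu> \<delta> C (min \<rho> \<kappa>) G \<theta>0 \<phi>"
  proof
    show "\<forall>\<^sub>F n in sequentially. \<delta> \<le> pr (\<lambda>w. passage n 0 w < \<mu> * real n - C * root 3 (real n))"
      using low_passage by (simp add: diff_less_eq)
    show "upper_tail_bound (\<lambda>n z. \<mu> * real n - G * (real_of_int z)\<^sup>2 / real n) (min \<rho> \<kappa>) \<theta>0 \<phi>"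
      using parabolic_mean_le[OF mean pos(5)] upper(1) by (rule upper_tail_bound_recentre)
    show "\<exists>D>0. \<forall>\<^sub>F n in sequentially. \<forall>z. \<bar>real_of_int z\<bar> \<le> (root 3 (real n))\<^sup>2 \<longrightarrow>
        1 - \<epsilon> \<le> pr (\<lambda>w. \<mu> * real n - D * root 3 (real n) \<le> passage n z w)" if "0 < \<epsilon>" for \<epsilon>
      using pos by (intro lower_tight_of_lower_tail[OF _ mean_ge lower(1) _ lower(2) that]) simp_all
  qed (use pos upper(2) in auto)
  then show ?thesis
  proof (rule lpp_fluctuations.recentred_lower_tail_ge)
    show "\<forall>\<^sub>F n in sequentially. \<mu> * real n - (G + H + g1) * root 3 (real n) \<le> mean n 0"
      using mean_ge by (rule eventually_mono) (auto dest: spec[of _ 0])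
  qed
qed

end

locale iid_weights = prob_space M for M :: "'a measure" +
  fixes \<xi> :: "int \<times> int \<Rightarrow> 'a \<Rightarrow> real"
  assumes rv: "\<xi> v \<in> borel_measurable M"
    and indep: "indep_vars (\<lambda>_. borel) \<xi> UNIV"
    and ident: "distr M borel (\<xi> v) = distr M borel (\<xi> (0, 0))"
    and nonneg: "AE \<omega> in M. 0 \<le> \<xi> v \<omega>"
begin

abbreviation weight_law :: "real measure" where
  "weight_law \<equiv> distr M borel (\<xi> (0, 0))"

sublocale field: iid_field weight_law
proof -
  interpret law: prob_space weight_law by (intro prob_space_distr rv)
  show "iid_field weight_law"
    by unfold_locales (use nonneg rv in \<open>auto simp: AE_distr_iff\<close>)
qed

lemma distr_weights: "distr M (PiM UNIV (\<lambda>_. borel)) (\<lambda>\<omega> v. \<xi> v \<omega>) = field.env"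
proof -
  have "distr M (PiM UNIV (\<lambda>_. borel)) (\<lambda>\<omega>. \<lambda>v\<in>UNIV. \<xi> v \<omega>) = PiM UNIV (\<lambda>v. distr M borel (\<xi> v))"
    using indep rv by (subst (asm) indep_vars_iff_distr_eq_PiM) auto
  also have "(\<lambda>v. distr M borel (\<xi> v)) = (\<lambda>_. weight_law)" using ident by blast
  finally show ?thesis by (simp add: field.env_def restrict_def)
qed

lemma prob_weights_eq_pr:
  assumes "Measurable.pred field.env Q"
  shows "prob {\<omega> \<in> space M. Q (\<lambda>v. \<xi> v \<omega>)} = field.pr Q"
proof -
  have weights: "(\<lambda>\<omega> v. \<xi> v \<omega>) \<in> measurable M (PiM UNIV (\<lambda>_. borel))"
    by (rule measurable_PiM_single') (use rv in \<open>auto simp: space_PiM\<close>)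
  have "{w. Q w} \<in> sets (PiM UNIV (\<lambda>_. borel))"
    using field.pred_sets[OF assms] unfolding distr_weights[symmetric] by simp
  then have "measure (distr M (PiM UNIV (\<lambda>_. borel)) (\<lambda>\<omega> v. \<xi> v \<omega>)) {w. Q w}
      = prob {\<omega> \<in> space M. Q (\<lambda>v. \<xi> v \<omega>)}"
    by (subst measure_distr[OF weights]) (auto intro!: arg_cong[of _ _ prob])
  then show ?thesis by (simp add: distr_weights field.pr_def)
qed

lemma prob_Xrz_eq_pr:
  shows prob_Xrz_less_eq_pr:
      "prob {\<omega> \<in> space M. Xrz \<xi> r z \<omega> - a < t} = field.pr (\<lambda>w. passage r z w - a < t)"
    and prob_Xrz_greater_eq_pr:
      "prob {\<omega> \<in> space M. Xrz \<xi> r z \<omega> - a > t} = field.pr (\<lambda>w. passage r z w - a > t)"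
    and prob_Xrz_le_eq_pr:
      "prob {\<omega> \<in> space M. Xrz \<xi> r z \<omega> - a \<le> t} = field.pr (\<lambda>w. passage r z w - a \<le> t)"
  unfolding Xrz_eq_passage by (rule prob_weights_eq_pr, measurable)+

end

theorem theorem4:
  fixes M :: "'a measure" and \<xi> :: "int \<times> int \<Rightarrow> 'a \<Rightarrow> real"
    and \<mu> :: real and \<alpha> :: real
  assumes P: "prob_space M"
    and rv: "\<And>v. \<xi> v \<in> borel_measurable M"
    and indep: "prob_space.indep_vars M (\<lambda>_. borel) \<xi> UNIV"
    and ident: "\<And>v. distr M borel (\<xi> v) = distr M borel (\<xi> (0, 0))"
    and nonneg: "\<And>v. AE \<omega> in M. 0 \<le> \<xi> v \<omega>"
    and integ: "\<And>v. integrable M (\<xi> v)"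
    and mu: "(\<lambda>r::nat. prob_space.expectation M (Xrz \<xi> r 0) / real r) \<longlonglongrightarrow> \<mu>"
    and LS: "\<exists>\<rho>>0. \<exists>G>0. \<exists>H>0. \<exists>g1>0. \<exists>g2>0. \<exists>r0::real. \<forall>r::nat. real r > r0 \<longrightarrow>
        (\<forall>z::int. \<bar>real_of_int z\<bar> \<le> \<rho> * real r \<longrightarrow>
          \<mu> * real r - G * real_of_int z ^ 2 / real r - H * real_of_int z ^ 4 / real r ^ 3
              - g1 * real r powr (1/3)
            \<le> prob_space.expectation M (Xrz \<xi> r z) \<and>
          prob_space.expectation M (Xrz \<xi> r z)
            \<le> \<mu> * real r - G * real_of_int z ^ 2 / real r - g2 * real r powr (1/3))"
    and alpha_pos: "\<alpha> > 0"
    and UT: "\<forall>\<epsilon>>0. \<exists>c>0. \<exists>\<theta>0>0. \<exists>r0>0. \<forall>r::nat. \<forall>\<theta>::real. \<forall>z::int.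
        real r > r0 \<and> \<theta> > \<theta>0 \<and> \<bar>real_of_int z\<bar> \<le> (1 - \<epsilon>) * real r \<longrightarrow>
        prob_space.prob M {\<omega> \<in> space M. Xrz \<xi> r z \<omega> - prob_space.expectation M (Xrz \<xi> r z)
            > \<theta> * real r powr (1/3)} \<le> exp (- c * \<theta> powr \<alpha>)"
    and LT: "\<forall>\<epsilon>>0. \<exists>c>0. \<exists>\<theta>0>0. \<exists>r0>0. \<forall>r::nat. \<forall>\<theta>::real. \<forall>z::int.
        real r > r0 \<and> \<theta> > \<theta>0 \<and> \<bar>real_of_int z\<bar> \<le> (1 - \<epsilon>) * real r \<longrightarrow>
        prob_space.prob M {\<omega> \<in> space M. Xrz \<xi> r z \<omega> - prob_space.expectation M (Xrz \<xi> r z)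
            < - \<theta> * real r powr (1/3)} \<le> exp (- c * \<theta> powr \<alpha>)"
    and LB: "\<exists>\<delta>>0. \<exists>C>0. \<exists>r0::real. \<forall>r::nat. real r > r0 \<longrightarrow>
        prob_space.prob M {\<omega> \<in> space M. Xrz \<xi> r 0 \<omega> - \<mu> * real r < - C * real r powr (1/3)} \<ge> \<delta>"
  shows "\<exists>c>0. \<exists>\<eta>>0. \<exists>\<theta>0::real. \<exists>r0::real. \<forall>r::nat. \<forall>\<theta>::real.
      real r > r0 \<and> \<theta>0 < \<theta> \<and> \<theta> < \<eta> * real r powr (2/3) \<longrightarrow>
      prob_space.prob M {\<omega> \<in> space M. Xrz \<xi> r 0 \<omega> - prob_space.expectation M (Xrz \<xi> r 0)
          \<le> - \<theta> * real r powr (1/3)} \<ge> exp (- c * \<theta> ^ 3)"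
proof -
  interpret iid_weights M \<xi>
    using P rv indep ident nonneg by (simp add: iid_weights_def iid_weights_axioms_def)
  note to_field = eventually_sequentially_real powr_third powr_two_thirds prob_Xrz_eq_pr
    imp_conjL all_simps
  let ?mean = "\<lambda>r z. expectation (Xrz \<xi> r z)"
  obtain \<rho> G H g1 g2 where LS_pos: "0 < \<rho>" "0 < G" "0 < H" "0 < g1" "0 < g2"
    and LS_mean: "parabolic_mean \<mu> \<rho> G H g1 g2 ?mean"
    using LS[folded eventually_sequentially_real, unfolded powr_third, folded parabolic_mean_def]
    by blast
  obtain c \<theta>0 where "0 < c" "0 < \<theta>0"
    and upper: "field.upper_tail_bound ?mean (1 - 1 / 2) \<theta>0 (\<lambda>\<theta>. exp (- c * \<theta> powr \<alpha>))"
    using UT[rule_format, OF half_gt_zero, OF zero_less_one]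
    unfolding field.upper_tail_bound_def to_field by blast
  obtain c' \<theta>0' where "0 < c'"
    and lower: "field.lower_tail_bound ?mean (1 - 1 / 2) \<theta>0' (\<lambda>\<theta>. exp (- c' * \<theta> powr \<alpha>))"
    using LT[rule_format, OF half_gt_zero, OF zero_less_one]
    unfolding field.lower_tail_bound_def to_field by blast
  obtain \<delta> C where "0 < \<delta>" "0 < C" and low_passage: "\<forall>\<^sub>F r in sequentially.
      \<delta> \<le> field.pr (\<lambda>w. passage r 0 w - \<mu> * real r < - C * root 3 (real r))"
    using LB[folded eventually_sequentially_real, unfolded powr_third prob_Xrz_eq_pr] by blast
  have decay: "((\<lambda>\<theta>. \<theta> ^ 4 * exp (- c * \<theta> powr \<alpha>)) \<longlongrightarrow> 0) at_top"
    "((\<lambda>\<theta>. exp (- c' * \<theta> powr \<alpha>)) \<longlongrightarrow> 0) at_top"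
    using \<open>0 < c\<close> \<open>0 < c'\<close> alpha_pos by real_asymp+
  from field.lower_tail_lower_bound[OF LS_mean upper decay(1) lower decay(2) low_passage]
    LS_pos \<open>0 < \<theta>0\<close> \<open>0 < \<delta>\<close> \<open>0 < C\<close>
  show ?thesis unfolding to_field by simp
qed

end
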